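(* Let $1\le m\le N$ be integers, let $\mathbf{A}\in\mathbb{R}^{N\times N}$ be a fixed matrix, and let $\mathbf{\Omega}\in\mathbb{R}^{N\times m}$ be a random matrix with i.i.d. $\mathcal{N}(0,1)$ entries. Let $\mathbf{Q}\in\mathbb{R}^{N\times m}$ be any orthonormal basis for the column space $\mathcal{R}(\mathbf{\Omega})$ (i.e. $\mathbf{Q}$ has orthonormal columns and $\mathcal{R}(\mathbf{Q})=\mathcal{R}(\mathbf{\Omega})$), and let $\mathbf{U}\in\mathbb{R}^{m\times m}$ be a random orthogonal matrix, Haar-distributed on the orthogonal group and independent of $(\mathbf{\Omega},\mathbf{Q})$. Then, almost surely, $$\mathbb{E}\left[\mathrm{XTraceFull}_{\mathbf{A}}(\mathbf{\Omega})\,\middle|\,\mathcal{R}(\mathbf{\Omega})\right]=\mathbb{E}\left[\mathrm{LeaveOneOutFull}_{\mathbf{A}}(\mathbf{Q}\mathbf{U})\,\middle|\,\mathbf{Q}\right]=\mathbb{E}\left[\mathrm{XTraceFull}_{\mathbf{A}}(\mathbf{Q}\mathbf{U})\,\middle|\,\mathbf{Q}\right].$$ Moreover, the value of $\mathrm{LeaveOneOutFull}_{\mathbf{A}}(\mathbf{Q}\mathbf{U})$ depends only on $\mathbf{Q}$ and the last column of $\mathbf{U}$.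
   Context: For a matrix $\mathbf{X}$, $\mathcal{R}(\mathbf{X})$ is its column space and $\mathbf{X}_{-i}$ is $\mathbf{X}$ with its $i$th column removed. Conditioning on $\mathcal{R}(\mathbf{\Omega})$ means conditioning on the random subspace $\mathcal{R}(\mathbf{\Omega})$ (equivalently, on the orthogonal projector onto it). Leave-one-out estimate. Given $\mathbf{A}\in\mathbb{R}^{N\times N}$, $\mathbf{\Omega}\in\mathbb{R}^{N\times m}$ with columns $\bm{\omega}_1,\dots,\bm{\omega}_m$, and $i\in\{1,\dots,m\}$, let $\mathbf{Q}_{(i)}$ be a matrix whose columns form an orthonormal basis of $\mathcal{R}([(\mathbf{A}\mathbf{\Omega})_{-i},\,\mathbf{\Omega}_{-i}])$. Put $\bm{\mu}=(\mathbf{I}-\mathbf{Q}_{(i)}\mathbf{Q}_{(i)}^T)\bm{\omega}_i$, $\bm{\nu}=\sqrt{N-\operatorname{rank}(\mathbf{Q}_{(i)})}\cdot\bm{\mu}/\|\bm{\mu}\|_2$ (with $\bm{\nu}=\mathbf{0}$ if $\bm{\mu}=\mathbf{0}$), and $$\widehat{\operatorname{tr}}_i=\operatorname{tr}(\mathbf{Q}_{(i)}^T\mathbf{A}\mathbf{Q}_{(i)})+\bm{\nu}^T\mathbf{A}\bm{\nu}.$$ This value does not depend on the choice of orthonormal basis $\mathbf{Q}_{(i)}$. Then $\mathrm{LeaveOneOutFull}_{\mathbf{A}}(\mathbf{\Omega}):=\widehat{\operatorname{tr}}_m$ (the last column is the one left out), and $\mathrm{XTraceFull}_{\mathbf{A}}(\mathbf{\Omega}):=\frac1m\sum_{i=1}^m\widehat{\operatorname{tr}}_i$.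 *)

theory Defs
  imports "HOL-Probability.Probability"
begin

section \<open>Column spaces and orthogonal projectors\<close>

definition col_space :: "real ^ 'm ^ 'n \<Rightarrow> (real ^ 'n) set"
  where "col_space X = span (columns X)"

text \<open>
  A matrix with orthonormal columns spanning \<open>S\<close> is represented by the set \<open>B\<close> of its columns, because
  the number of columns depends on the data. Orthonormal columns are distinct, so no column is lost.
\<close>

definition orthonormal_basis :: "(real ^ 'n) set \<Rightarrow> (real ^ 'n) set \<Rightarrow> bool"
  where "orthonormal_basis B S \<longleftrightarrow> pairwise orthogonal B \<and> (\<forall>b\<in>B. norm b = 1) \<and> span B = S"

definition orth_projector :: "(real ^ 'n) set \<Rightarrow> real ^ 'n ^ 'n"
  where "orth_projector S =
    (THE P. transpose P = P \<and> P ** P = P \<and> range (\<lambda>x. P *v x) = S)"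


section \<open>Leave-one-out trace estimators\<close>

text \<open>The column space of the block matrix \<open>[(A X)\<^sub>-\<^sub>i, X\<^sub>-\<^sub>i]\<close>.\<close>

definition loo_space :: "real ^ 'n ^ 'n \<Rightarrow> real ^ 'm ^ 'n \<Rightarrow> 'm \<Rightarrow> (real ^ 'n) set"
  where "loo_space A X i =
    span ({column j (A ** X) |j. j \<noteq> i} \<union> {column j X |j. j \<noteq> i})"

text \<open>
  With \<open>B\<close> the set of columns of \<open>Q\<close>: \<open>Q Q\<^sup>T x = (\<Sum>b\<in>B. (b \<bullet> x) *\<^sub>R b)\<close>,
  \<open>tr (Q\<^sup>T A Q) = (\<Sum>b\<in>B. b \<bullet> (A *v b))\<close> and \<open>rank Q = dim B\<close>.
\<close>

definition loo_residual :: "real ^ 'm ^ 'n \<Rightarrow> 'm \<Rightarrow> (real ^ 'n) set \<Rightarrow> real ^ 'n"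
  where "loo_residual X i B = column i X - (\<Sum>b\<in>B. (b \<bullet> column i X) *\<^sub>R b)"

definition loo_direction :: "real ^ 'm ^ 'n \<Rightarrow> 'm \<Rightarrow> (real ^ 'n) set \<Rightarrow> real ^ 'n"
  where "loo_direction X i B =
    (let \<mu> = loo_residual X i B in
     if \<mu> = 0 then 0 else (sqrt (real CARD('n) - real (dim B)) / norm \<mu>) *\<^sub>R \<mu>)"

definition loo_trace_basis ::
    "real ^ 'n ^ 'n \<Rightarrow> real ^ 'm ^ 'n \<Rightarrow> 'm \<Rightarrow> (real ^ 'n) set \<Rightarrow> real"
  where "loo_trace_basis A X i B =
    (\<Sum>b\<in>B. b \<bullet> (A *v b)) +
    (let \<nu> = loo_direction X i B in \<nu> \<bullet> (A *v \<nu>))"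

text \<open>The choice of basis is immaterial; see \<open>loo_trace_eq\<close> below.\<close>

definition loo_trace :: "real ^ 'n ^ 'n \<Rightarrow> real ^ 'm ^ 'n \<Rightarrow> 'm \<Rightarrow> real"
  where "loo_trace A X i =
    loo_trace_basis A X i (SOME B. orthonormal_basis B (loo_space A X i))"

definition LeaveOneOutFull :: "real ^ 'n ^ 'n \<Rightarrow> real ^ ('m::{finite,linorder}) ^ 'n \<Rightarrow> real"
  where "LeaveOneOutFull A X = loo_trace A X (Max UNIV)"

definition XTraceFull :: "real ^ 'n ^ 'n \<Rightarrow> real ^ 'm ^ 'n \<Rightarrow> real"
  where "XTraceFull A X = (1 / real CARD('m)) * (\<Sum>i\<in>UNIV. loo_trace A X i)"


section \<open>Random matrices and conditioning\<close>

definition standard_gaussian_matrix :: "'a measure \<Rightarrow> ('a \<Rightarrow> real ^ 'm ^ 'n) \<Rightarrow> bool"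
  where "standard_gaussian_matrix M X \<longleftrightarrow>
    prob_space.indep_vars M (\<lambda>_. borel) (\<lambda>(i, j) \<omega>. X \<omega> $ i $ j) UNIV \<and>
    (\<forall>i j. distributed M lborel (\<lambda>\<omega>. X \<omega> $ i $ j) std_normal_density)"

text \<open>
  Haar probability measure on the orthogonal group, viewed as a Borel measure on all square matrices
  that is concentrated on the group and invariant under left translation.
\<close>

definition haar_orthogonal :: "(real ^ 'm ^ 'm) measure \<Rightarrow> bool"
  where "haar_orthogonal \<mu> \<longleftrightarrow>
    prob_space \<mu> \<and> sets \<mu> = sets borel \<and> (AE U in \<mu>. orthogonal_matrix U) \<and>
    (\<forall>V. orthogonal_matrix V \<longrightarrow> distr \<mu> borel (\<lambda>U. V ** U) = \<mu>)"

text \<open>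
  Independence of random variables with different value types, which \<open>indep_var\<close> does not allow.
\<close>

definition independent_rvs ::
    "'a measure \<Rightarrow> ('a \<Rightarrow> 'b::topological_space) \<Rightarrow> ('a \<Rightarrow> 'c::topological_space) \<Rightarrow> bool"
  where "independent_rvs M X Y \<longleftrightarrow>
    prob_space.indep_set M (sets (vimage_algebra (space M) X borel))
      (sets (vimage_algebra (space M) Y borel))"

text \<open>Conditional expectation of \<open>f\<close> given the random variable \<open>X\<close>, as a random variable on \<open>M\<close>.\<close>

definition cond_exp_given ::
    "'a measure \<Rightarrow> ('a \<Rightarrow> 'b::topological_space) \<Rightarrow> ('a \<Rightarrow> real) \<Rightarrow> 'a \<Rightarrow> real"
  where "cond_exp_given M X f = real_cond_exp M (vimage_algebra (space M) X borel) f"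


section \<open>Well-definedness\<close>

lemma orthonormal_basis_finite:
  assumes "orthonormal_basis B S"
  shows "finite B"
proof -
  have "0 \<notin> B" using assms by (auto simp: orthonormal_basis_def)
  then show ?thesis
    using assms pairwise_orthogonal_independent finiteI_independent
    unfolding orthonormal_basis_def by blast
qed

lemma orthonormal_basis_exists:
  fixes S :: "(real ^ 'n) set"
  assumes "subspace S"
  shows "\<exists>B. orthonormal_basis B S"
  using orthonormal_basis_subspace[OF assms] unfolding orthonormal_basis_def by metis

lemma orthonormal_sum_orthogonal:
  fixes B :: "(real ^ 'n) set"
  assumes B: "orthonormal_basis B S" and y: "y \<in> S"
  shows "(x - (\<Sum>b\<in>B. (b \<bullet> x) *\<^sub>R b)) \<bullet> y = 0"
proof -
  have perp: "orthogonal (x - (\<Sum>b\<in>B. (b \<bullet> x) *\<^sub>R b)) c" if c: "c \<in> B" for c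
  proof -
    have "(\<Sum>b\<in>B. (b \<bullet> x) *\<^sub>R b) \<bullet> c = (\<Sum>b\<in>B. if b = c then c \<bullet> x else 0)"
      unfolding inner_sum_left
    proof (rule sum.cong[OF refl])
      fix b assume b: "b \<in> B"
      have "b \<bullet> c = (if b = c then 1 else 0)"
        using B b c unfolding orthonormal_basis_def pairwise_def orthogonal_def
        by (auto simp: norm_eq_1)
      then show "((b \<bullet> x) *\<^sub>R b) \<bullet> c = (if b = c then c \<bullet> x else 0)" by simp
    qed
    also have "\<dots> = c \<bullet> x" using c orthonormal_basis_finite[OF B] by simp
    finally show ?thesis by (simp add: orthogonal_def inner_diff_left inner_commute[of x c])
  qed
  have "y \<in> span B" using y B by (simp add: orthonormal_basis_def)
  then have "orthogonal (x - (\<Sum>b\<in>B. (b \<bullet> x) *\<^sub>R b)) y"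
    by (rule orthogonal_to_span) (rule perp)
  then show ?thesis by (simp add: orthogonal_def)
qed

lemma orthonormal_sum_in:
  assumes "orthonormal_basis B S"
  shows "(\<Sum>b\<in>B. (b \<bullet> x) *\<^sub>R b) \<in> S"
proof -
  have "(\<Sum>b\<in>B. (b \<bullet> x) *\<^sub>R b) \<in> span B" by (intro span_sum span_scale span_base)
  then show ?thesis using assms by (simp add: orthonormal_basis_def)
qed

lemma orthonormal_sum_unique:
  fixes B C :: "(real ^ 'n) set"
  assumes B: "orthonormal_basis B S" and C: "orthonormal_basis C S"
  shows "(\<Sum>b\<in>B. (b \<bullet> x) *\<^sub>R b) = (\<Sum>c\<in>C. (c \<bullet> x) *\<^sub>R c)"
proof -
  define p where "p = (\<Sum>b\<in>B. (b \<bullet> x) *\<^sub>R b)"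
  define q where "q = (\<Sum>c\<in>C. (c \<bullet> x) *\<^sub>R c)"
  have S: "subspace S" using B unfolding orthonormal_basis_def by auto
  have "p \<in> S" "q \<in> S" unfolding p_def q_def by (rule orthonormal_sum_in, fact)+
  then have d: "p - q \<in> S" by (rule subspace_diff[OF S])
  have "(x - p) \<bullet> (p - q) = 0" unfolding p_def by (rule orthonormal_sum_orthogonal[OF B d[unfolded p_def]])
  moreover have "(x - q) \<bullet> (p - q) = 0" unfolding q_def by (rule orthonormal_sum_orthogonal[OF C d[unfolded q_def]])
  ultimately have "(p - q) \<bullet> (p - q) = 0" by (simp add: inner_diff_left)
  then show ?thesis by (simp add: p_def q_def)
qed

lemma orthonormal_trace:
  fixes A :: "real ^ 'n ^ 'n"
  shows "(\<Sum>b\<in>B. b \<bullet> (A *v b)) = (\<Sum>e\<in>Basis. e \<bullet> (A *v (\<Sum>b\<in>B. (b \<bullet> e) *\<^sub>R b)))"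
proof -
  have "(\<Sum>b\<in>B. b \<bullet> (A *v b)) = (\<Sum>b\<in>B. \<Sum>e\<in>Basis. (b \<bullet> e) * ((A *v b) \<bullet> e))"
    by (rule sum.cong[OF refl]) (rule euclidean_inner)
  also have "\<dots> = (\<Sum>e\<in>Basis. \<Sum>b\<in>B. (b \<bullet> e) * ((A *v b) \<bullet> e))" by (rule sum.swap)
  also have "\<dots> = (\<Sum>e\<in>Basis. e \<bullet> (A *v (\<Sum>b\<in>B. (b \<bullet> e) *\<^sub>R b)))"
    by (rule sum.cong[OF refl])
      (simp add: linear_sum[OF matrix_vector_mul_linear] inner_sum_right
        matrix_vector_mult_scaleR inner_commute)
  finally show ?thesis .
qed

lemma loo_trace_eq:
  assumes B: "orthonormal_basis B (loo_space A X i)"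
  shows "loo_trace A X i = loo_trace_basis A X i B"
proof -
  define C where "C = (SOME C. orthonormal_basis C (loo_space A X i))"
  have C: "orthonormal_basis C (loo_space A X i)" unfolding C_def by (rule someI[of _ B]) (rule B)
  have "dim C = dim B" using B C unfolding orthonormal_basis_def by (metis dim_span)
  moreover have "loo_residual X i C = loo_residual X i B"
    unfolding loo_residual_def orthonormal_sum_unique[OF B C] ..
  ultimately show ?thesis
    unfolding loo_trace_def C_def[symmetric] loo_trace_basis_def loo_direction_def
      orthonormal_trace[where B = B] orthonormal_trace[where B = C] orthonormal_sum_unique[OF B C]
    by (simp add: Let_def)
qed

lemma orth_projector_unique:
  fixes P R :: "real ^ 'n ^ 'n"
  assumes P: "transpose P = P" "P ** P = P" and R: "transpose R = R" "R ** R = R"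
    and eq: "range (\<lambda>x. P *v x) = range (\<lambda>x. R *v x)"
  shows "P = R"
proof -
  have PR: "P ** R = R"
  proof -
    have "P *v (R *v x) = R *v x" for x
    proof -
      obtain y where "R *v x = P *v y" using eq by (metis rangeE rangeI)
      then show ?thesis using P(2) by (metis matrix_vector_mul_assoc)
    qed
    then show ?thesis by (simp add: matrix_eq flip: matrix_vector_mul_assoc)
  qed
  have RP: "R ** P = P"
  proof -
    have "R *v (P *v x) = P *v x" for x
    proof -
      obtain y where "P *v x = R *v y" using eq by (metis rangeE rangeI)
      then show ?thesis using R(2) by (metis matrix_vector_mul_assoc)
    qed
    then show ?thesis by (simp add: matrix_eq flip: matrix_vector_mul_assoc)
  qed
  have "R = transpose (P ** R)" using PR R by simp
  also have "\<dots> = R ** P" using P R by (simp add: matrix_transpose_mul)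
  finally show ?thesis using RP by simp
qed

lemma orth_projector_orthonormal_basis:
  fixes S :: "(real ^ 'n) set"
  assumes B: "orthonormal_basis B S"
  shows "orth_projector S = matrix (\<lambda>x. \<Sum>b\<in>B. (b \<bullet> x) *\<^sub>R b)"
proof -
  define p where "p = (\<lambda>x. \<Sum>b\<in>B. (b \<bullet> x) *\<^sub>R b)"
  define P where "P = matrix p"
  have lin: "linear p"
    unfolding p_def by (intro linearI)
      (simp_all add: inner_add_right scaleR_add_left sum.distrib scaleR_sum_right)
  have P: "P *v x = p x" for x unfolding P_def by (simp add: matrix_works lin)
  have p_in: "p x \<in> S" for x unfolding p_def by (rule orthonormal_sum_in[OF B])
  have fix_p: "p y = y" if y: "y \<in> S" for y
  proof -
    have "subspace S" using B unfolding orthonormal_basis_def by auto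
    then have "y - p y \<in> S"
      using y p_in by (intro subspace_diff)
    then have "(y - p y) \<bullet> (y - p y) = 0"
      unfolding p_def by (rule orthonormal_sum_orthogonal[OF B])
    then show ?thesis by simp
  qed
  have range: "range (\<lambda>x. P *v x) = S" unfolding P using p_in fix_p by (auto simp: image_iff) metis
  have idem: "P ** P = P" by (simp add: matrix_eq P p_in fix_p flip: matrix_vector_mul_assoc)
  have "x \<bullet> (transpose P *v y) = x \<bullet> (P *v y)" for x y
  proof -
    have "x \<bullet> (transpose P *v y) = p x \<bullet> y"
      by (metis P dot_lmul_matrix transpose_matrix_vector inner_commute)
    also have "\<dots> = x \<bullet> p y"
      unfolding p_def inner_sum_left inner_sum_right by (simp add: inner_commute mult.commute)
    finally show ?thesis by (simp add: P)
  qed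
  then have sym: "transpose P = P" by (metis matrix_eq vector_eq_ldot)
  show ?thesis
    unfolding orth_projector_def p_def[symmetric] P_def[symmetric]
  proof (rule the_equality)
    show "transpose P = P \<and> P ** P = P \<and> range (\<lambda>x. P *v x) = S"
      using range idem sym by blast
    show "R = P" if "transpose R = R \<and> R ** R = R \<and> range (\<lambda>x. R *v x) = S" for R
    proof (rule orth_projector_unique)
      show "range (\<lambda>x. R *v x) = range (\<lambda>x. P *v x)" using that range by blast
    qed (use that idem sym in blast)+
  qed
qed

end

theory Submission
  imports Defs
begin

text \<open>
  The idea is that the leave-one-out estimate knows very little about its test matrix. Let \<open>X\<close> have
  linearly independent columns, let \<open>S\<close> be its column space, and let \<open>n\<^sub>i \<in> S\<close> be the unit vector (unique
  up to sign) orthogonal to all columns but the \<open>i\<close>th. The span of the retained columns is the orthogonal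
  complement of \<open>n\<^sub>i\<close> in \<open>S\<close>, and the omitted column is a nonzero multiple of \<open>n\<^sub>i\<close> modulo that span, so
  the \<open>i\<close>th estimate is a function of \<open>S\<close> and of \<open>n\<^sub>i\<close> up to sign (\<open>loo_trace_cong\<close>,
  \<open>loo_trace_normal_cong\<close>). For \<open>X = Q U\<close> with orthonormal \<open>Q\<close> and orthogonal \<open>U\<close> the normal is \<open>Q u\<^sub>i\<close>,
  which proves the claim about the last column of \<open>U\<close>.

  It remains to see that, conditionally on \<open>S\<close>, the normal is uniformly distributed on the unit sphere of
  \<open>S\<close> in each of the three cases. For a matrix \<open>Q U R\<close> with \<open>U\<close> Haar distributed and \<open>R\<close> fixed and
  invertible, the normals are the columns of \<open>Q U W\<close> for suitable fixed orthogonal matrices \<open>W\<close>, and \<open>U W\<close>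
  has the law of \<open>U\<close>. Hence averaging over \<open>U\<close> gives the same number for every \<open>R\<close> and every omitted
  column (\<open>integral_haar_loo_trace\<close>). This settles the second equality and reduces the first one to
  the following: given \<open>S\<close>, the coordinates \<open>R = Q\<^sup>T \<Omega>\<close> may be replaced by \<open>U R\<close>.

  This invariance within \<open>S\<close> comes from the rotation invariance of the Gaussian law on the whole space.
  Multiply \<open>\<Omega>\<close> by an independent Haar-distributed orthogonal \<open>N \<times> N\<close> matrix \<open>V\<close>, which does not change
  its law, and freeze \<open>\<Omega> = P R\<close>. Right invariance of the law of \<open>V\<close> allows any rotation of the column space
  of \<open>P\<close> to be inserted between \<open>V\<close> and \<open>\<Omega>\<close> without disturbing the column space of \<open>V \<Omega>\<close>
  (\<open>integral_XTraceFull_on_projector_event\<close>). The ingredients are the rotation invariance of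
  Gaussian matrices, the existence of Haar measure on the orthogonal group, obtained by
  orthonormalising a Gaussian matrix, and the fact that a left-invariant probability measure on that
  group is also right invariant.

  Two measurability questions arise. The estimators are Borel because orthogonal projections can be
  computed by a Gram--Schmidt recursion, and the Haar average is a Borel function of the projector onto
  \<open>S\<close>, because it is also a Gaussian average of an expression in that projector
  (\<open>haar_xtrace_projector\<close>).
\<close>


section \<open>Gram--Schmidt projections\<close>

text \<open>
The orthogonal projection onto the span of a list of vectors that may be linearly dependent. It adds
one direction at a time; when \<open>v\<close> already lies in the span of the others, its residual vanishes and
adds nothing, whatever the quotient in front of it. Unlike a choice of orthonormal basis, this is an explicit
formula, so measurability in the vectors and equivariance under rotations follow by induction.
\<close>

fun gs_proj :: "'v::real_inner list \<Rightarrow> 'v \<Rightarrow> 'v" where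
  "gs_proj [] x = 0"
| "gs_proj (v # vs) x =
    gs_proj vs x + (((v - gs_proj vs v) \<bullet> x) / ((v - gs_proj vs v) \<bullet> (v - gs_proj vs v)))
      *\<^sub>R (v - gs_proj vs v)"

lemma gs_proj_in_span: "gs_proj vs x \<in> span (set vs)"
proof (induction vs arbitrary: x)
  case Nil
  then show ?case by simp
next
  case (Cons v vs)
  have *: "gs_proj vs y \<in> span (set (v # vs))" for y
    using Cons[of y] span_mono[of "set vs" "set (v # vs)"] by auto
  have "v \<in> span (set (v # vs))" by (simp add: span_base)
  then show ?case
    using * by (auto intro!: span_add span_scale span_diff)
qed

lemma gs_proj_orthogonal:
  assumes "y \<in> span (set vs)"
  shows "(x - gs_proj vs x) \<bullet> y = 0"
  using assms
proof (induction vs arbitrary: x y)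
  case Nil
  then show ?case by simp
next
  case (Cons v vs)
  define r where "r = v - gs_proj vs v"
  have r_perp: "r \<bullet> w = 0" if "w \<in> span (set vs)" for w
    unfolding r_def by (rule Cons.IH) (rule that)
  have perp: "(x - gs_proj (v # vs) x) \<bullet> w = 0" if "w \<in> span (set vs)" for w
    using r_perp[OF that] Cons.IH[OF that, of x]
    by (simp add: r_def[symmetric] inner_diff_left inner_add_left)
  have "(x - gs_proj (v # vs) x) \<bullet> r = 0"
    using r_perp[OF gs_proj_in_span[of vs x]]
    by (simp add: r_def[symmetric] inner_diff_left inner_add_left inner_commute[of x r]
        inner_commute[of "gs_proj vs x" r])
  moreover have "v = r + gs_proj vs v" by (simp add: r_def)
  ultimately have v: "(x - gs_proj (v # vs) x) \<bullet> v = 0"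
    using perp[OF gs_proj_in_span[of vs v]] by (metis inner_add_right add.right_neutral)
  have "orthogonal (x - gs_proj (v # vs) x) y"
  proof (rule orthogonal_to_span[OF Cons.prems])
    fix w assume "w \<in> set (v # vs)"
    then show "orthogonal (x - gs_proj (v # vs) x) w"
      using v perp[of w] by (auto simp: orthogonal_def span_base simp del: gs_proj.simps)
  qed
  then show ?case by (simp add: orthogonal_def del: gs_proj.simps)
qed

text \<open>
Both sides are the orthogonal projection onto the same subspace: their difference lies in that
subspace and is orthogonal to it. This turns statements about a chosen orthonormal basis into
statements about the explicit recursion.
\<close>

lemma gs_proj_orthonormal_basis:
  fixes vs :: "(real ^ 'n) list"
  assumes B: "orthonormal_basis B (span (set vs))"
  shows "gs_proj vs x = (\<Sum>b\<in>B. (b \<bullet> x) *\<^sub>R b)" (is "?p = ?q")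
proof -
  have d: "?p - ?q \<in> span (set vs)"
    by (intro span_diff gs_proj_in_span orthonormal_sum_in[OF B])
  have "(x - ?p) \<bullet> (?p - ?q) = 0" "(x - ?q) \<bullet> (?p - ?q) = 0"
    by (rule gs_proj_orthogonal[OF d], rule orthonormal_sum_orthogonal[OF B d])
  then have "(?p - ?q) \<bullet> (?p - ?q) = 0"
    by (simp add: inner_diff_left)
  then show ?thesis by simp
qed

lemma gs_proj_orthogonal_transformation:
  assumes "orthogonal_transformation f"
  shows "gs_proj (map f vs) (f x) = f (gs_proj vs x)"
proof (induction vs arbitrary: x)
  case Nil
  then show ?case
    using linear_0[OF orthogonal_transformation_linear[OF assms]] by simp
next
  case (Cons v vs)
  have "f v - f (gs_proj vs v) = f (v - gs_proj vs v)"
    using linear_diff[OF orthogonal_transformation_linear[OF assms]] by metis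
  then show ?case
    using assms linear_cmul[OF orthogonal_transformation_linear[OF assms]]
      linear_add[OF orthogonal_transformation_linear[OF assms]]
    by (simp add: Cons orthogonal_transformation_def)
qed

lemma gs_proj_measurable:
  fixes fs :: "('a \<Rightarrow> 'v::euclidean_space) list"
  assumes "\<And>f. f \<in> set fs \<Longrightarrow> f \<in> borel_measurable M" and "g \<in> borel_measurable M"
  shows "(\<lambda>\<omega>. gs_proj (map (\<lambda>f. f \<omega>) fs) (g \<omega>)) \<in> borel_measurable M"
  using assms
proof (induction fs arbitrary: g)
  case Nil
  then show ?case by simp
next
  case (Cons f fs)
  have [measurable]: "f \<in> borel_measurable M" "g \<in> borel_measurable M"
    using Cons.prems by auto
  have [measurable]: "(\<lambda>\<omega>. gs_proj (map (\<lambda>f. f \<omega>) fs) (h \<omega>)) \<in> borel_measurable M"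
    if "h \<in> borel_measurable M" for h
    by (rule Cons.IH) (use Cons.prems that in auto)
  show ?case by simp
qed


section \<open>Measurability of projectors and estimators\<close>

lemma borel_measurable_vec:
  fixes f :: "'a \<Rightarrow> 'b::euclidean_space ^ 'n"
  assumes "\<And>i. (\<lambda>\<omega>. f \<omega> $ i) \<in> borel_measurable M"
  shows "f \<in> borel_measurable M"
proof -
  have "(\<lambda>\<omega>. f \<omega> \<bullet> axis i b) \<in> borel_measurable M" if "b \<in> Basis" for i b
    using assms[of i] by (simp add: inner_axis)
  then show ?thesis
    by (subst borel_measurable_euclidean_space) (auto simp: Basis_vec_def)
qed

lemma borel_measurable_nth_vec [measurable (raw)]:
  fixes f :: "'a \<Rightarrow> 'b::euclidean_space ^ 'n"
  assumes "f \<in> borel_measurable M"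
  shows "(\<lambda>\<omega>. f \<omega> $ i) \<in> borel_measurable M"
proof -
  have "(\<lambda>x::'b^'n. x $ i) \<in> borel_measurable borel"
    by (intro borel_measurable_continuous_onI continuous_intros)
  then show ?thesis using assms by measurable
qed

lemma borel_measurable_column [measurable (raw)]:
  fixes f :: "'a \<Rightarrow> real ^ 'm ^ 'n"
  assumes [measurable]: "f \<in> borel_measurable M"
  shows "(\<lambda>\<omega>. column i (f \<omega>)) \<in> borel_measurable M"
  unfolding column_def by (rule borel_measurable_vec) simp

lemma borel_measurable_matrix_mult [measurable (raw)]:
  fixes f :: "'a \<Rightarrow> real ^ 'm ^ 'n" and g :: "'a \<Rightarrow> real ^ 'k ^ 'm"
  assumes [measurable]: "f \<in> borel_measurable M" "g \<in> borel_measurable M"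
  shows "(\<lambda>\<omega>. f \<omega> ** g \<omega>) \<in> borel_measurable M"
  unfolding matrix_matrix_mult_def by (intro borel_measurable_vec) simp

lemma borel_measurable_matrix_vector_mult [measurable (raw)]:
  fixes f :: "'a \<Rightarrow> real ^ 'm ^ 'n" and g :: "'a \<Rightarrow> real ^ 'm"
  assumes [measurable]: "f \<in> borel_measurable M" "g \<in> borel_measurable M"
  shows "(\<lambda>\<omega>. f \<omega> *v g \<omega>) \<in> borel_measurable M"
  unfolding matrix_vector_mult_def by (intro borel_measurable_vec) simp

lemma borel_measurable_transpose [measurable (raw)]:
  fixes f :: "'a \<Rightarrow> real ^ 'm ^ 'n"
  assumes [measurable]: "f \<in> borel_measurable M"
  shows "(\<lambda>\<omega>. transpose (f \<omega>)) \<in> borel_measurable M"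
  unfolding transpose_def by (intro borel_measurable_vec) simp

lemma borel_measurable_det:
  "(det :: real ^ 'n ^ 'n \<Rightarrow> real) \<in> borel_measurable borel"
proof -
  have "(\<lambda>X :: real ^ 'n ^ 'n. det X) \<in> borel_measurable borel"
    unfolding det_def by measurable
  then show ?thesis by simp
qed

lemma orth_projector_measurable:
  "(\<lambda>X :: real ^ 'm ^ 'n. orth_projector (col_space X)) \<in> borel_measurable borel"
proof -
  obtain js :: "'m list" where js: "set js = UNIV" using finite_list[OF finite] by blast
  have eq: "orth_projector (col_space X) = matrix (\<lambda>x. gs_proj (map (\<lambda>j. column j X) js) x)"
    for X :: "real ^ 'm ^ 'n"
  proof -
    have S: "col_space X = span (set (map (\<lambda>j. column j X) js))"
      using js by (auto simp: col_space_def columns_def intro!: arg_cong[where f = span])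
    obtain B where B: "orthonormal_basis B (col_space X)"
      using orthonormal_basis_exists[of "col_space X"] by (auto simp: col_space_def)
    show ?thesis
      unfolding orth_projector_orthonormal_basis[OF B] gs_proj_orthonormal_basis[OF B[unfolded S]] ..
  qed
  have "(\<lambda>X :: real ^ 'm ^ 'n. gs_proj (map (\<lambda>f. f X) (map (\<lambda>j X. column j X) js)) x) \<in> borel_measurable borel"
    for x
    by (rule gs_proj_measurable) auto
  then have [measurable]: "(\<lambda>X :: real ^ 'm ^ 'n. gs_proj (map (\<lambda>j. column j X) js) x) \<in> borel_measurable borel"
    for x by (simp add: comp_def)
  show ?thesis
    unfolding eq matrix_def by (intro borel_measurable_vec) simp
qed

text \<open>
The estimator is defined through an arbitrary choice of orthonormal basis, but it depends on the basis
only through the projection \<open>p\<close> onto its span: the trace term is \<open>tr (A p)\<close>, the dimension is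
\<open>tr p\<close>, and the residual is \<open>x - p x\<close>. With \<open>p\<close> written as a Gram--Schmidt recursion in the columns,
every ingredient is visibly Borel.
\<close>

lemma loo_trace_measurable:
  fixes A :: "real ^ 'n ^ 'n"
  shows "(\<lambda>X :: real ^ 'm ^ 'n. loo_trace A X i) \<in> borel_measurable borel"
proof -
  obtain js :: "'m list" where js: "set js = {j. j \<noteq> i}" using finite_list[of "{j. j \<noteq> i}"] by auto
  define vs where "vs X = map (\<lambda>j. column j (A ** X)) js @ map (\<lambda>j. column j X) js"
    for X :: "real ^ 'm ^ 'n"
  define p where "p X = gs_proj (vs X)" for X
  define \<mu> where "\<mu> X = column i X - p X (column i X)" for X
  define \<nu> where "\<nu> X = (if \<mu> X = 0 then 0
     else (sqrt (real CARD('n) - (\<Sum>e\<in>Basis. e \<bullet> p X e)) / norm (\<mu> X)) *\<^sub>R \<mu> X)" for X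
  have eq: "loo_trace A X i = (\<Sum>e\<in>Basis. e \<bullet> (A *v p X e)) + \<nu> X \<bullet> (A *v \<nu> X)" for X :: "real ^ 'm ^ 'n"
  proof -
    have S: "loo_space A X i = span (set (vs X))"
      using js by (auto simp: loo_space_def vs_def intro!: arg_cong[where f = span])
    obtain B where B: "orthonormal_basis B (loo_space A X i)"
      using orthonormal_basis_exists[of "loo_space A X i"] by (auto simp: loo_space_def)
    have p: "p X = (\<lambda>x. \<Sum>b\<in>B. (b \<bullet> x) *\<^sub>R b)"
      unfolding p_def using gs_proj_orthonormal_basis[OF B[unfolded S]] by auto
    have 1: "b \<bullet> b = 1" if "b \<in> B" for b
      using B that by (auto simp: orthonormal_basis_def norm_eq_1)
    have "0 \<notin> B" using B by (auto simp: orthonormal_basis_def)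
    then have "independent B"
      using B pairwise_orthogonal_independent by (auto simp: orthonormal_basis_def)
    then have "real (dim B) = (\<Sum>b\<in>B. b \<bullet> (mat 1 *v b))"
      using 1 by (simp add: dim_eq_card_independent)
    also have "\<dots> = (\<Sum>e\<in>Basis. e \<bullet> p X e)"
      unfolding orthonormal_trace p by simp
    finally have d: "real (dim B) = (\<Sum>e\<in>Basis. e \<bullet> p X e)" .
    have "loo_direction X i B = \<nu> X"
      unfolding loo_direction_def loo_residual_def \<nu>_def \<mu>_def d p Let_def by simp
    then show ?thesis
      unfolding loo_trace_eq[OF B] loo_trace_basis_def Let_def orthonormal_trace p by simp
  qed
  have [measurable]: "(\<lambda>X. p X (g X)) \<in> borel_measurable borel" if "g \<in> borel_measurable borel" for g
  proof -
    have "(\<lambda>X :: real ^ 'm ^ 'n. gs_proj (map (\<lambda>f. f X)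
        (map (\<lambda>j X. column j (A ** X)) js @ map (\<lambda>j X. column j X) js)) (g X)) \<in> borel_measurable borel"
      by (rule gs_proj_measurable) (use that in auto)
    then show ?thesis by (simp add: p_def vs_def comp_def)
  qed
  have [measurable]: "\<mu> \<in> borel_measurable borel" unfolding \<mu>_def by measurable
  have [measurable]: "\<nu> \<in> borel_measurable borel" unfolding \<nu>_def by measurable
  show ?thesis unfolding eq by measurable
qed

text \<open>
The trace term has at most \<open>N\<close> summands, each bounded by the operator norm of \<open>A\<close>, and the rescaled
residual has squared norm at most \<open>N\<close>. Hence all expectations below exist, whatever the law of the
test matrix.
\<close>

lemma loo_trace_bounded:
  fixes A :: "real ^ 'n ^ 'n"
  obtains C where "\<And>(X :: real ^ 'm ^ 'n) i. \<bar>loo_trace A X i\<bar> \<le> C"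
proof -
  define K where "K = onorm ((*v) A)"
  have bl: "bounded_linear ((*v) A)" by (rule matrix_vector_mul_bounded_linear)
  have K: "0 \<le> K" unfolding K_def by (rule onorm_pos_le) (rule bl)
  have q: "\<bar>x \<bullet> (A *v x)\<bar> \<le> K * (norm x)\<^sup>2" for x
  proof -
    have "\<bar>x \<bullet> (A *v x)\<bar> \<le> norm x * norm (A *v x)" by (rule Cauchy_Schwarz_ineq2)
    also have "\<dots> \<le> norm x * (K * norm x)"
      unfolding K_def by (intro mult_left_mono onorm bl) auto
    finally show ?thesis by (simp add: power2_eq_square mult.left_commute mult.commute)
  qed
  have "\<bar>loo_trace A X i\<bar> \<le> real CARD('n) * K + K * real CARD('n)" for X :: "real ^ 'm ^ 'n" and i
  proof -
    obtain B where B: "orthonormal_basis B (loo_space A X i)"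
      using orthonormal_basis_exists[of "loo_space A X i"] by (auto simp: loo_space_def)
    have "0 \<notin> B" using B by (auto simp: orthonormal_basis_def)
    then have "independent B"
      using B pairwise_orthogonal_independent by (auto simp: orthonormal_basis_def)
    then have card: "card B \<le> CARD('n)"
      using independent_bound[of B] by simp
    have "\<bar>\<Sum>b\<in>B. b \<bullet> (A *v b)\<bar> \<le> (\<Sum>b\<in>B. K)"
    proof (intro order_trans[OF sum_abs] sum_mono)
      show "\<bar>b \<bullet> (A *v b)\<bar> \<le> K" if "b \<in> B" for b
        using q[of b] B that by (simp add: orthonormal_basis_def)
    qed
    also have "\<dots> \<le> real CARD('n) * K"
      using card K by (simp add: mult_right_mono)
    finally have 1: "\<bar>\<Sum>b\<in>B. b \<bullet> (A *v b)\<bar> \<le> real CARD('n) * K" .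
    define \<nu> where "\<nu> = loo_direction X i B"
    have dle: "dim B \<le> CARD('n)" using dim_subset_UNIV[of B] by simp
    have "(norm \<nu>)\<^sup>2 \<le> real CARD('n)"
      using dle by (auto simp: \<nu>_def loo_direction_def Let_def real_sqrt_pow2 abs_of_nonneg)
    then have 2: "\<bar>\<nu> \<bullet> (A *v \<nu>)\<bar> \<le> K * real CARD('n)"
      using q[of \<nu>] K by (meson mult_left_mono order_trans)
    show ?thesis
      using 1 2 unfolding loo_trace_eq[OF B] loo_trace_basis_def Let_def \<nu>_def[symmetric] by linarith
  qed
  then show thesis using that by blast
qed


section \<open>The geometry of leaving one column out\<close>

lemma column_matrix_mult: "column j (P ** R) = P *v column j R"
  by (simp add: column_def matrix_matrix_mult_def matrix_vector_mult_def vec_eq_iff)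

lemma matrix_mult_add_rdistrib: "(X + Y) ** Z = X ** Z + Y ** (Z :: real ^ 'k ^ 'm)"
  and matrix_mult_diff_ldistrib: "Z ** (V - W) = Z ** V - Z ** (W :: real ^ 'l ^ 'k)"
  and matrix_mult_diff_rdistrib: "(X - Y) ** Z = X ** Z - Y ** Z"
  by (simp_all add: matrix_matrix_mult_def vec_eq_iff sum.distrib sum_subtractf algebra_simps)

lemma matrix_vector_mult_axis: "X *v axis k (1::real) = column k X"
  by (simp add: column_def matrix_vector_mult_def vec_eq_iff axis_def if_distrib cong: if_cong)

lemma col_space_eq_range: "col_space (X :: real ^ 'm ^ 'n) = range ((*v) X)"
proof
  have "column j X \<in> range ((*v) X)" for j
    by (metis matrix_vector_mult_axis rangeI)
  then show "col_space X \<subseteq> range ((*v) X)"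
    unfolding col_space_def columns_def
    by (intro span_minimal linear_subspace_image matrix_vector_mul_linear subspace_UNIV) auto
  show "range ((*v) X) \<subseteq> col_space X"
    using matrix_vector_mult_in_columnspace by (auto simp: col_space_def)
qed

lemma col_space_mult_invertible:
  fixes X :: "real ^ 'm ^ 'n" and R :: "real ^ 'm ^ 'm"
  assumes "invertible R"
  shows "col_space (X ** R) = col_space X"
proof -
  obtain S where "R ** S = mat 1" using assms by (auto simp: invertible_def)
  then have "X *v x = (X ** R) *v (S *v x)" for x
    by (metis matrix_mul_assoc matrix_mul_rid matrix_vector_mul_assoc)
  moreover have "(X ** R) *v x = X *v (R *v x)" for x
    by (simp add: matrix_vector_mul_assoc)
  ultimately show ?thesis unfolding col_space_eq_range by (metis image_subset_iff rangeI subset_antisym)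
qed

lemma orth_projector_orthonormal_columns:
  fixes P :: "real ^ 'm ^ 'n"
  assumes P: "transpose P ** P = mat 1"
  shows "orth_projector (col_space P) = P ** transpose P"
  unfolding orth_projector_def
proof (rule the_equality)
  have fix_P: "(P ** transpose P) ** P = P"
    by (metis P matrix_mul_assoc matrix_mul_rid)
  have "range (\<lambda>x. (P ** transpose P) *v x) = col_space P"
    unfolding col_space_eq_range
    by (metis (no_types, lifting) fix_P image_subset_iff matrix_vector_mul_assoc rangeI subset_antisym)
  moreover have "transpose (P ** transpose P) = P ** transpose P"
    by (simp add: matrix_transpose_mul)
  moreover have "(P ** transpose P) ** (P ** transpose P) = P ** transpose P"
    by (metis fix_P matrix_mul_assoc)
  ultimately show *: "transpose (P ** transpose P) = P ** transpose P \<and>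
      (P ** transpose P) ** (P ** transpose P) = P ** transpose P \<and>
      range (\<lambda>x. (P ** transpose P) *v x) = col_space P"
    by blast
  show "R = P ** transpose P"
    if "transpose R = R \<and> R ** R = R \<and> range (\<lambda>x. R *v x) = col_space P" for R
    by (rule orth_projector_unique) (use that * in auto)
qed

text \<open>
A matrix with the same column space as \<open>P\<close> is fixed by the projector \<open>P P\<^sup>T\<close>. Conversely \<open>P = X S\<close>
for some \<open>S\<close>, and \<open>(P\<^sup>T X) S = P\<^sup>T P = I\<close>, so the coordinate matrix is invertible.
\<close>

lemma factor_through_orthonormal_columns:
  fixes P X :: "real ^ 'm ^ 'n"
  assumes P: "transpose P ** P = mat 1" and eq: "col_space P = col_space X"
  shows "P ** (transpose P ** X) = X" and "invertible (transpose P ** X)"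
proof -
  have fix_P: "(P ** transpose P) *v (P *v y) = P *v y" for y
    by (metis P matrix_mul_assoc matrix_mul_rid matrix_vector_mul_assoc)
  have "(P ** (transpose P ** X)) *v x = X *v x" for x
  proof -
    obtain y where "X *v x = P *v y"
      using eq by (metis col_space_eq_range rangeE rangeI)
    then show ?thesis by (metis fix_P matrix_mul_assoc matrix_vector_mul_assoc)
  qed
  then show "P ** (transpose P ** X) = X" by (simp add: matrix_eq)
  have "\<exists>y. P *v x = X *v y" for x
    using eq by (metis col_space_eq_range rangeE rangeI)
  then obtain g where g: "\<And>x. P *v x = X *v g x" by metis
  define S where "S = (\<chi> i j. g (axis j 1) $ i)"
  have "column j (X ** S) = column j P" for j
  proof -
    have "column j S = g (axis j 1)" by (simp add: S_def column_def vec_eq_iff)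
    then show ?thesis by (metis column_matrix_mult g matrix_vector_mult_axis)
  qed
  then have "X ** S = P" by (simp add: column_def vec_eq_iff)
  then have "(transpose P ** X) ** S = mat 1" by (metis P matrix_mul_assoc)
  then show "invertible (transpose P ** X)" by (auto simp: invertible_right_inverse)
qed

text \<open>
The condition \<open>R\<^sup>T w = c e\<^sub>i\<close> says that \<open>w\<close> spans the dual direction to column \<open>i\<close>:
\<open>w \<bullet> R x = c x\<^sub>i\<close>, so \<open>R x\<close> is orthogonal to \<open>w\<close> exactly when it does not use column \<open>i\<close>.
\<close>

lemma span_other_columns_eq_orthogonal_complement:
  fixes R :: "real ^ 'm ^ 'm"
  assumes R: "invertible R" and w: "transpose R *v w = c *\<^sub>R axis i 1" and c: "c \<noteq> 0"
  shows "span {column j R |j. j \<noteq> i} = {v. w \<bullet> v = 0}"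
proof
  have dual: "w \<bullet> (R *v x) = c * x $ i" for x
  proof -
    have "w \<bullet> (R *v x) = (transpose R *v w) \<bullet> x"
      by (simp add: dot_lmul_matrix transpose_matrix_vector)
    then show ?thesis unfolding w by (simp add: inner_axis')
  qed
  have "w \<bullet> column j R = 0" if "j \<noteq> i" for j
    using dual[of "axis j 1"] that unfolding matrix_vector_mult_axis by (simp add: axis_def)
  then show "span {column j R |j. j \<noteq> i} \<subseteq> {v. w \<bullet> v = 0}"
    by (intro span_minimal subspace_hyperplane) auto
  show "{v. w \<bullet> v = 0} \<subseteq> span {column j R |j. j \<noteq> i}"
  proof clarify
    fix v assume v: "w \<bullet> v = 0"
    obtain S where "R ** S = mat 1" using R by (auto simp: invertible_def)
    then have Rx: "R *v (S *v v) = v" by (simp add: matrix_vector_mul_assoc)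
    then have 0: "(S *v v) $ i = 0" using dual[of "S *v v"] v c by simp
    have "R *v (S *v v) = (\<Sum>j\<in>UNIV. (S *v v) $ j *s column j R)" by (rule matrix_mult_sum)
    also have "\<dots> \<in> span {column j R |j. j \<noteq> i}"
    proof (rule span_sum)
      fix j
      show "(S *v v) $ j *s column j R \<in> span {column j R |j. j \<noteq> i}"
        using 0 unfolding scalar_mult_eq_scaleR
        by (cases "j = i") (simp_all add: span_zero, blast intro: span_scale span_base)
    qed
    finally show "v \<in> span {column j R |j. j \<noteq> i}" unfolding Rx .
  qed
qed

lemma loo_space_eq:
  fixes A :: "real ^ 'n ^ 'n" and X :: "real ^ 'm ^ 'n"
  shows "loo_space A X i = {a + b |a b. a \<in> (*v) A ` span {column j X |j. j \<noteq> i}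
    \<and> b \<in> span {column j X |j. j \<noteq> i}}"
proof -
  have "{column j (A ** X) |j. j \<noteq> i} = (*v) A ` {column j X |j. j \<noteq> i}"
    by (auto simp: column_matrix_mult)
  then show ?thesis
    unfolding loo_space_def by (simp add: span_Un linear_span_image)
qed

text \<open>
The estimator only sees the span \<open>L\<close> of the retained columns and the omitted column modulo \<open>L\<close>, up
to a nonzero factor: the projected-out subspace is \<open>L + A L\<close>, the part of the omitted column in \<open>L\<close>
leaves no residual, and rescaling the omitted column changes the normalised residual at most by a
sign, which the quadratic form \<open>\<nu>\<^sup>T A \<nu>\<close> ignores.
\<close>

lemma loo_trace_cong:
  fixes A :: "real ^ 'n ^ 'n" and X :: "real ^ 'm ^ 'n" and Y :: "real ^ 'k ^ 'n"
  assumes L: "span {column j X |j. j \<noteq> i} = span {column j Y |j. j \<noteq> k}"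
    and col: "column i X = c *\<^sub>R column k Y + l" and c: "c \<noteq> 0"
    and l: "l \<in> span {column j Y |j. j \<noteq> k}"
  shows "loo_trace A X i = loo_trace A Y k"
proof -
  have S: "loo_space A X i = loo_space A Y k" unfolding loo_space_eq L ..
  obtain B where B: "orthonormal_basis B (loo_space A Y k)"
    using orthonormal_basis_exists[of "loo_space A Y k"] by (auto simp: loo_space_def)
  define p where "p x = (\<Sum>b\<in>B. (b \<bullet> x) *\<^sub>R b)" for x
  have "l \<in> loo_space A Y k"
    using l span_zero[of "{column j Y |j. j \<noteq> k}"] unfolding loo_space_eq
    by (force simp: image_iff intro: exI[of _ 0] bexI[of _ 0])
  moreover have "p l \<in> loo_space A Y k" unfolding p_def by (rule orthonormal_sum_in[OF B])
  ultimately have "l - p l \<in> loo_space A Y k"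
    unfolding loo_space_def by (intro span_diff)
  then have "(l - p l) \<bullet> (l - p l) = 0"
    unfolding p_def by (rule orthonormal_sum_orthogonal[OF B])
  then have pl: "p l = l" by simp
  have "p (column i X) = c *\<^sub>R p (column k Y) + p l"
    unfolding p_def col
    by (simp add: inner_add_right scaleR_add_left sum.distrib scaleR_sum_right)
  then have res: "loo_residual X i B = c *\<^sub>R loo_residual Y k B"
    unfolding loo_residual_def p_def[symmetric] by (simp add: col pl scaleR_diff_right)
  have dir: "loo_direction X i B = sgn c *\<^sub>R loo_direction Y k B"
    using c unfolding loo_direction_def res
    by (simp add: Let_def sgn_real_def abs_if)
  show ?thesis
    using c loo_trace_eq[OF B] loo_trace_eq[OF B[folded S]]
    unfolding loo_trace_basis_def dir
    by (simp add: Let_def matrix_vector_mult_scaleR sgn_real_def)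
qed

text \<open>
What matters is the normal to the retained columns, in coordinates with respect to \<open>P\<close>. For \<open>P R\<close>
and index \<open>i\<close> it is proportional to \<open>R\<^sup>-\<^sup>T e\<^sub>i\<close>; for \<open>P W\<close> with \<open>W\<close> orthogonal and index \<open>k\<close> it is column
\<open>k\<close> of \<open>W\<close>. If the two normals agree, so do the estimates. This is how a Gaussian test matrix is
compared with an orthonormal one.
\<close>

lemma loo_trace_normal_cong:
  fixes A :: "real ^ 'n ^ 'n" and P :: "real ^ 'm ^ 'n" and R :: "real ^ 'm ^ 'm"
  assumes R: "invertible R" and W: "orthogonal_matrix W"
    and w: "transpose R *v column k W = c *\<^sub>R axis i 1" and c: "c \<noteq> 0"
  shows "loo_trace A (P ** R) i = loo_trace A (P ** W) k"
proof -
  let ?w = "column k W"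
  have W': "invertible W" "transpose W ** W = mat 1"
    using W by (auto simp: orthogonal_matrix_def invertible_def)
  have "transpose W *v ?w = 1 *\<^sub>R axis k 1"
    by (metis W'(2) matrix_vector_mul_assoc matrix_vector_mul_lid matrix_vector_mult_axis scaleR_one)
  then have LW: "span {column j W |j. j \<noteq> k} = {v. ?w \<bullet> v = 0}"
    by (rule span_other_columns_eq_orthogonal_complement[OF W'(1)]) simp
  have LR: "span {column j R |j. j \<noteq> i} = {v. ?w \<bullet> v = 0}"
    by (rule span_other_columns_eq_orthogonal_complement[OF R w c])
  have im: "span {column j (P ** Z) |j. j \<noteq> h} = (*v) P ` span {column j Z |j. j \<noteq> h}"
    for Z :: "real ^ 'm ^ 'm" and h
  proof -
    have "{column j (P ** Z) |j. j \<noteq> h} = (*v) P ` {column j Z |j. j \<noteq> h}"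
      by (auto simp: column_matrix_mult)
    then show ?thesis by (simp add: linear_span_image)
  qed
  have 1: "?w \<bullet> ?w = 1"
    using W by (simp add: orthogonal_matrix_orthonormal_columns norm_eq_1)
  have "?w \<bullet> column i R = (transpose R *v ?w) \<bullet> axis i 1"
    unfolding matrix_vector_mult_axis[of R i, symmetric]
    by (simp only: dot_lmul_matrix transpose_matrix_vector)
  then have "?w \<bullet> column i R = c" unfolding w by (simp add: inner_axis_axis)
  then have "?w \<bullet> (column i R - c *\<^sub>R ?w) = 0" by (simp add: inner_diff_right 1)
  then have l: "P *v (column i R - c *\<^sub>R ?w) \<in> span {column j (P ** W) |j. j \<noteq> k}"
    unfolding im LW by blast
  have "span {column j (P ** R) |j. j \<noteq> i} = span {column j (P ** W) |j. j \<noteq> k}"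
    unfolding im LW LR ..
  moreover have "column i (P ** R) = c *\<^sub>R column k (P ** W) + P *v (column i R - c *\<^sub>R ?w)"
    by (simp add: column_matrix_mult matrix_vector_mult_diff_distrib matrix_vector_mult_scaleR)
  ultimately show ?thesis using c l by (rule loo_trace_cong)
qed

lemma loo_trace_last_column:
  fixes P :: "real ^ 'm ^ 'n"
  assumes "orthogonal_matrix V" "orthogonal_matrix W" "column k V = column k W"
  shows "loo_trace A (P ** V) k = loo_trace A (P ** W) k"
proof (rule loo_trace_normal_cong)
  show "invertible V" using assms(1) by (auto simp: orthogonal_matrix_def invertible_def)
  show "transpose V *v column k W = 1 *\<^sub>R axis k 1"
    using assms(1) unfolding assms(3)[symmetric] orthogonal_matrix
    by (metis matrix_vector_mul_assoc matrix_vector_mul_lid matrix_vector_mult_axis scaleR_one)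
qed (use assms in auto)

lemma orthogonal_matrix_with_normal:
  fixes R :: "real ^ 'm ^ 'm"
  assumes R: "invertible R"
  obtains W c where "orthogonal_matrix W" "c \<noteq> 0" "transpose R *v column k W = c *\<^sub>R axis i 1"
proof -
  obtain S where "S ** R = mat 1" using R by (auto simp: invertible_def)
  then have TS: "transpose R ** transpose S = mat 1"
    by (metis matrix_transpose_mul transpose_mat)
  define w where "w = transpose S *v axis i 1"
  have Rw: "transpose R *v w = axis i 1"
    unfolding w_def by (metis TS matrix_vector_mul_assoc matrix_vector_mul_lid)
  then have nz: "w \<noteq> 0" by (metis axis_eq_0_iff matrix_vector_mult_0_right zero_neq_one)
  then have "norm (w /\<^sub>R norm w) = 1" by simp
  then obtain W where W: "orthogonal_matrix W" "W *v axis k 1 = w /\<^sub>R norm w"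
    by (rule orthogonal_matrix_exists_basis)
  show thesis
  proof
    show "orthogonal_matrix W" "1 / norm w \<noteq> 0" using W nz by auto
    show "transpose R *v column k W = (1 / norm w) *\<^sub>R axis i 1"
      using W(2) Rw by (simp add: matrix_vector_mult_axis matrix_vector_mult_scaleR inverse_eq_divide)
  qed
qed

text \<open>
A rotation \<open>U\<close> of the coordinates with respect to \<open>P\<close> extends to a rotation of the whole space that
is the identity on the orthogonal complement of the column space:
\<open>V = P U P\<^sup>T + (I - P P\<^sup>T)\<close>.
\<close>

lemma orthogonal_matrix_extends_rotation:
  fixes P :: "real ^ 'm ^ 'n"
  assumes P: "transpose P ** P = mat 1" and U: "orthogonal_matrix U"
  obtains V where "orthogonal_matrix V" "V ** P = P ** U" "transpose P ** V = U ** transpose P"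
proof -
  define V where "V = P ** U ** transpose P + (mat 1 - P ** transpose P)"
  have PP: "transpose P ** (P ** X) = X" for X :: "real ^ 'k ^ 'm"
    by (metis P matrix_mul_assoc matrix_mul_lid)
  have UU: "U ** (transpose U ** X) = X" "transpose U ** (U ** X) = X" for X :: "real ^ 'k ^ 'm"
    using U by (metis matrix_mul_assoc matrix_mul_lid orthogonal_matrix_def)+
  show thesis
  proof
    have tV: "transpose V = P ** transpose U ** transpose P + (mat 1 - P ** transpose P)"
    proof -
      have "transpose (X + Y) = transpose X + transpose Y"
        "transpose (X - Y) = transpose X - transpose Y" for X Y :: "real ^ 'n ^ 'n"
        by (simp_all add: transpose_def vec_eq_iff)
      then show ?thesis
        by (simp add: V_def matrix_transpose_mul matrix_mul_assoc transpose_mat)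
    qed
    show "V ** P = P ** U"
      by (simp add: V_def matrix_mult_add_rdistrib matrix_mult_diff_rdistrib P flip: matrix_mul_assoc)
    show "transpose P ** V = U ** transpose P"
      by (simp add: V_def matrix_add_ldistrib matrix_mult_diff_ldistrib PP flip: matrix_mul_assoc)
    show "orthogonal_matrix V"
      unfolding orthogonal_matrix tV
      by (simp add: V_def matrix_add_ldistrib matrix_mult_diff_ldistrib matrix_mult_add_rdistrib
          matrix_mult_diff_rdistrib PP UU flip: matrix_mul_assoc)
  qed
qed


section \<open>Rotation invariance of the Gaussian measure\<close>

text \<open>
Uniqueness of translation-invariant measures. The double integral of \<open>1\<^sub>A(x) 1\<^sub>B(y)\<close> becomes, after
shifting \<open>y\<close> by \<open>x\<close> and then \<open>x\<close> by \<open>-y\<close>, the double integral of \<open>1\<^sub>A(x - y) 1\<^sub>B(x)\<close>; integrating over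
\<open>y\<close> first gives the right-hand side.
\<close>

lemma translation_invariant_measure_proportional:
  fixes \<mu> :: "'v::euclidean_space measure"
  assumes "sigma_finite_measure \<mu>" and sets [measurable_cong]: "sets \<mu> = sets borel"
    and inv: "\<And>c. distr \<mu> borel ((+) c) = \<mu>"
    and [measurable]: "A \<in> sets borel" "B \<in> sets borel"
  shows "emeasure \<mu> A * emeasure lborel B = emeasure lborel A * emeasure \<mu> B"
proof -
  interpret \<mu>: sigma_finite_measure \<mu> by fact
  interpret pair_sigma_finite \<mu> "lborel :: 'v measure"
    by (intro pair_sigma_finite.intro assms(1) sigma_finite_lborel)
  have shift_\<mu>: "(\<integral>\<^sup>+x. f (c + x) \<partial>\<mu>) = (\<integral>\<^sup>+x. f x \<partial>\<mu>)" if [measurable]: "f \<in> borel_measurable borel" for f c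
    by (subst (2) inv[of c, symmetric]) (simp add: nn_integral_distr)
  have shift_l: "(\<integral>\<^sup>+x. f (c + x) \<partial>lborel) = (\<integral>\<^sup>+x. f x \<partial>lborel)"
    if [measurable]: "f \<in> borel_measurable borel" for f and c :: 'v
    by (subst (2) lborel_distr_plus[of c, symmetric]) (simp add: nn_integral_distr)
  have reflect: "(\<integral>\<^sup>+y. f (c - y) \<partial>lborel) = (\<integral>\<^sup>+x. f x \<partial>lborel)"
    if [measurable]: "f \<in> borel_measurable borel" for f and c :: 'v
    by (subst (2) lborel_affine[of "-1" c]) (simp_all add: density_1 nn_integral_distr)
  have "emeasure \<mu> A * emeasure lborel B = (\<integral>\<^sup>+x. \<integral>\<^sup>+y. indicator A x * indicator B y \<partial>lborel \<partial>\<mu>)"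
    by (simp add: nn_integral_cmult nn_integral_multc)
  also have "\<dots> = (\<integral>\<^sup>+x. \<integral>\<^sup>+y. indicator A x * indicator B (x + y) \<partial>lborel \<partial>\<mu>)"
    using shift_l[of "\<lambda>y. indicator A x * indicator B y" for x] by simp
  also have "\<dots> = (\<integral>\<^sup>+y. \<integral>\<^sup>+x. indicator A x * indicator B (x + y) \<partial>\<mu> \<partial>lborel)"
    by (rule Fubini'[symmetric]) measurable
  also have "\<dots> = (\<integral>\<^sup>+y. \<integral>\<^sup>+x. indicator A (x - y) * indicator B x \<partial>\<mu> \<partial>lborel)"
    using shift_\<mu>[of "\<lambda>x. indicator A (x - y) * indicator B x" y for y] by (simp add: add.commute)
  also have "\<dots> = (\<integral>\<^sup>+x. \<integral>\<^sup>+y. indicator A (x - y) * indicator B x \<partial>lborel \<partial>\<mu>)"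
    by (rule Fubini') measurable
  also have "\<dots> = (\<integral>\<^sup>+x. \<integral>\<^sup>+y. indicator A y * indicator B x \<partial>lborel \<partial>\<mu>)"
    using reflect[of "\<lambda>y. indicator A y * indicator B x" x for x] by simp
  also have "\<dots> = emeasure lborel A * emeasure \<mu> B"
    by (simp add: nn_integral_cmult nn_integral_multc)
  finally show ?thesis .
qed

text \<open>
The image of Lebesgue measure under a rotation is again translation invariant, hence a multiple of
Lebesgue measure; the factor is 1 because the unit ball is mapped onto itself.
\<close>

lemma lborel_orthogonal_transformation:
  fixes f :: "'v::euclidean_space \<Rightarrow> 'v"
  assumes f: "orthogonal_transformation f"
  shows "distr lborel borel f = lborel"
proof (rule measure_eqI)
  have lin: "linear f" using f by (rule orthogonal_transformation_linear)
  have [measurable]: "f \<in> borel_measurable borel"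
    using lin by (intro borel_measurable_continuous_onI linear_continuous_on linear_conv_bounded_linear[THEN iffD1])
  have ball: "emeasure (distr lborel borel f) (ball 0 r) = emeasure lborel (ball (0::'v) r)" for r
  proof -
    have "f -` ball 0 r = ball (0::'v) r" using f by (auto simp: orthogonal_transformation)
    then show ?thesis by (simp add: emeasure_distr)
  qed
  show "sets (distr lborel borel f) = sets lborel" by simp
  have sf: "sigma_finite_measure (distr lborel borel f)"
  proof
    have "(\<Union>n::nat. ball 0 (real n)) = (UNIV :: 'v set)"
      by (auto simp: dist_norm intro: reals_Archimedean2)
    then show "\<exists>A. countable A \<and> A \<subseteq> sets (distr lborel borel f) \<and> \<Union> A = space (distr lborel borel f) \<and>
        (\<forall>a\<in>A. emeasure (distr lborel borel f) a \<noteq> \<infinity>)"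
      using ball emeasure_lborel_ball_finite[of "0 :: 'v"]
      by (intro exI[of _ "range (\<lambda>n::nat. ball 0 (real n))"]) (auto simp: less_top)
  qed
  have inv: "distr (distr lborel borel f) borel ((+) c) = distr lborel borel f" for c
  proof -
    obtain d where d: "c = f d" using orthogonal_transformation_surj[OF f] by (metis surjD)
    have "distr (distr lborel borel f) borel ((+) c) = distr lborel borel (\<lambda>x. f (d + x))"
      by (subst distr_distr) (auto simp: comp_def d linear_add[OF lin])
    also have "\<dots> = distr (distr lborel borel ((+) d)) borel f"
      by (subst distr_distr) (auto simp: comp_def)
    finally show ?thesis by (simp add: lborel_distr_plus)
  qed
  fix A assume "A \<in> sets (distr lborel borel f)"
  then have [measurable]: "A \<in> sets borel" by simp
  have "emeasure (distr lborel borel f) A * emeasure lborel (ball (0::'v) 1)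
      = emeasure lborel A * emeasure lborel (ball (0::'v) 1)"
    using translation_invariant_measure_proportional[OF sf _ inv, of A "ball 0 1"] by (simp add: ball)
  moreover have "emeasure lborel (ball (0::'v) 1) \<noteq> 0" "emeasure lborel (ball (0::'v) 1) \<noteq> \<infinity>"
    using emeasure_lborel_ball_finite[of "0::'v" 1] content_ball_pos[of 1 "0::'v"]
    by (auto simp: measure_def)
  ultimately show "emeasure (distr lborel borel f) A = emeasure lborel A"
    by (metis ennreal_mult_cancel_left infinity_ennreal_def mult.commute)
qed

definition std_gaussian :: "'v::euclidean_space measure"
  where "std_gaussian = density lborel (\<lambda>x. \<Prod>b\<in>Basis. ennreal (std_normal_density (x \<bullet> b)))"

lemma sets_std_gaussian [simp, measurable_cong]: "sets std_gaussian = sets borel"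
  and space_std_gaussian [simp]: "space std_gaussian = UNIV"
  by (simp_all add: std_gaussian_def)

lemma prob_space_std_gaussian: "prob_space (std_gaussian :: 'v::euclidean_space measure)"
proof
  have 1: "(\<integral>\<^sup>+x. ennreal (std_normal_density x) \<partial>lborel) = 1"
    by (subst nn_integral_eq_integral) (auto simp: integrable_normal_density integral_normal_density)
  have "emeasure std_gaussian (space (std_gaussian :: 'v measure))
      = (\<integral>\<^sup>+x. (\<Prod>b\<in>Basis. ennreal (std_normal_density (x \<bullet> b))) \<partial>(lborel :: 'v measure))"
    by (simp add: std_gaussian_def emeasure_density)
  also have "\<dots> = (\<Prod>b\<in>(Basis :: 'v set). \<integral>\<^sup>+x. ennreal (std_normal_density x) \<partial>lborel)"
    by (rule nn_integral_lborel_prod) auto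
  also have "\<dots> = 1" using 1 by simp
  finally show "emeasure std_gaussian (space (std_gaussian :: 'v measure)) = 1" .
qed

text \<open>
The product of the one-dimensional densities is a function of the norm alone.
\<close>

lemma std_gaussian_orthogonal_transformation:
  fixes f :: "'v::euclidean_space \<Rightarrow> 'v"
  assumes f: "orthogonal_transformation f"
  shows "distr std_gaussian borel f = std_gaussian"
proof (rule measure_eqI)
  have [measurable]: "f \<in> borel_measurable borel"
    using orthogonal_transformation_linear[OF f]
    by (intro borel_measurable_continuous_onI linear_continuous_on linear_conv_bounded_linear[THEN iffD1])
  define g where "g x = (\<Prod>b\<in>Basis. ennreal (std_normal_density (x \<bullet> b)))" for x :: 'v
  have [measurable]: "g \<in> borel_measurable borel" unfolding g_def by measurable
  have g: "g x = ennreal ((1 / sqrt (2 * pi)) ^ DIM('v) * exp (- (norm x)\<^sup>2 / 2))" for x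
  proof -
    have "(\<Sum>b\<in>Basis. (x \<bullet> b)\<^sup>2) = (norm x)\<^sup>2"
      by (subst power2_norm_eq_inner, subst euclidean_inner[of x x]) (simp add: power2_eq_square)
    then have "(\<Sum>b\<in>Basis. - (x \<bullet> b)\<^sup>2 / 2) = - (norm x)\<^sup>2 / 2"
      by (simp add: sum_negf flip: sum_divide_distrib)
    then show ?thesis
      by (simp add: g_def prod_ennreal std_normal_density_def prod.distrib prod_dividef
          power_divide flip: exp_sum)
  qed
  have gf: "g (f x) = g x" for x
    using f by (simp add: g orthogonal_transformation_norm)
  fix A assume "A \<in> sets (distr std_gaussian borel f)"
  then have [measurable]: "A \<in> sets borel" by simp
  have [measurable]: "f -` A \<in> sets borel" by (rule measurable_sets_borel) measurable
  have "emeasure (distr std_gaussian borel f) A = (\<integral>\<^sup>+x. g x * indicator A (f x) \<partial>lborel)"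
    unfolding std_gaussian_def g_def[symmetric]
    by (auto simp: emeasure_distr emeasure_density indicator_def intro!: nn_integral_cong)
  also have "\<dots> = (\<integral>\<^sup>+x. g (f x) * indicator A (f x) \<partial>lborel)" by (simp add: gf)
  also have "\<dots> = (\<integral>\<^sup>+x. g x * indicator A x \<partial>distr lborel borel f)"
    by (simp add: nn_integral_distr)
  also have "\<dots> = emeasure std_gaussian A"
    unfolding lborel_orthogonal_transformation[OF f]
    by (simp add: std_gaussian_def g_def[symmetric] emeasure_density)
  finally show "emeasure (distr std_gaussian borel f) A = emeasure std_gaussian A" .
qed simp

lemma orthogonal_transformation_matrix_mult:
  fixes V :: "real ^ 'n ^ 'n"
  assumes V: "orthogonal_matrix V"
  shows "orthogonal_transformation (\<lambda>X :: real ^ 'm ^ 'n. V ** X)"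
proof -
  have cols: "X \<bullet> Y = (\<Sum>j\<in>UNIV. column j X \<bullet> column j Y)" for X Y :: "real ^ 'm ^ 'n"
    unfolding inner_vec_def column_def by (simp add: sum.swap[of _ "UNIV :: 'm set"])
  have "orthogonal_transformation ((*v) V)"
    using V by (simp add: orthogonal_transformation_matrix)
  then have "(V *v x) \<bullet> (V *v y) = x \<bullet> y" for x y
    by (simp add: orthogonal_transformation_def)
  moreover have "linear (\<lambda>X :: real ^ 'm ^ 'n. V ** X)"
    by (rule linearI) (simp_all add: matrix_add_ldistrib matrix_scaleR
        scalar_mult_eq_scaleR matrix_matrix_mult_def vec_eq_iff sum_distrib_left
        sum.distrib distrib_left mult.left_commute)
  ultimately show ?thesis
    by (simp add: orthogonal_transformation_def cols column_matrix_mult)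
qed

lemma std_gaussian_matrix_mult:
  fixes V :: "real ^ 'n ^ 'n"
  assumes "orthogonal_matrix V"
  shows "distr std_gaussian borel (\<lambda>X :: real ^ 'm ^ 'n. V ** X) = std_gaussian"
  by (intro std_gaussian_orthogonal_transformation orthogonal_transformation_matrix_mult assms)

text \<open>
Both measures factorise over the entries, so they agree on boxes, which generate the Borel sets.
\<close>

lemma distr_standard_gaussian_matrix:
  fixes X :: "'a \<Rightarrow> real ^ 'm ^ 'n"
  assumes "prob_space M" and X: "standard_gaussian_matrix M X"
  shows "X \<in> borel_measurable M" and "distr M borel X = std_gaussian"
proof -
  interpret prob_space M by fact
  have entry [measurable]: "(\<lambda>\<omega>. X \<omega> $ i $ j) \<in> borel_measurable M"
    and dist: "distributed M lborel (\<lambda>\<omega>. X \<omega> $ i $ j) std_normal_density" for i j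
    using X distributed_measurable[of M lborel "\<lambda>\<omega>. X \<omega> $ i $ j"]
    unfolding standard_gaussian_matrix_def by auto
  show meas [measurable]: "X \<in> borel_measurable M"
    by (intro borel_measurable_vec entry)
  interpret G: prob_space "std_gaussian :: (real ^ 'm ^ 'n) measure" by (rule prob_space_std_gaussian)
  let ?D = "distr M borel X" and ?G = "std_gaussian :: (real ^ 'm ^ 'n) measure"
  let ?E = "range (\<lambda>(a, b). box a b :: (real ^ 'm ^ 'n) set)"
  have basis: "(\<Prod>b\<in>Basis. h b) = (\<Prod>(i, j)\<in>UNIV. h (axis i (axis j 1)))" for h :: "real ^ 'm ^ 'n \<Rightarrow> ennreal"
  proof -
    have "inj (\<lambda>(i, j). axis i (axis j 1) :: real ^ 'm ^ 'n)"
      by (auto simp: inj_def axis_eq_axis)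
    moreover have B: "(Basis :: (real ^ 'm ^ 'n) set) = range (\<lambda>(i, j). axis i (axis j 1))"
      by (auto simp: Basis_vec_def)
    ultimately show ?thesis unfolding B by (subst prod.reindex) (auto intro!: prod.cong)
  qed
  have box: "emeasure ?D (box a b) = emeasure ?G (box a b)" for a b
  proof -
    have mem: "x \<in> box a b \<longleftrightarrow> (\<forall>i j. x $ i $ j \<in> {a $ i $ j <..< b $ i $ j})" for x
      by (auto simp: mem_box Basis_vec_def inner_axis)
    have "emeasure ?D (box a b) = emeasure M (X -` box a b \<inter> space M)"
      by (simp add: emeasure_distr)
    also have "X -` box a b \<inter> space M
        = (\<Inter>p\<in>UNIV. (\<lambda>\<omega>. X \<omega> $ fst p $ snd p) -` {a $ fst p $ snd p <..< b $ fst p $ snd p} \<inter> space M)"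
      by (auto simp: mem)
    also have "emeasure M \<dots> = (\<Prod>p\<in>UNIV. emeasure M
        ((\<lambda>\<omega>. X \<omega> $ fst p $ snd p) -` {a $ fst p $ snd p <..< b $ fst p $ snd p} \<inter> space M))"
    proof -
      have "indep_vars (\<lambda>_. borel) (\<lambda>p \<omega>. X \<omega> $ fst p $ snd p) UNIV"
      proof -
        have "(\<lambda>(i, j) \<omega>. X \<omega> $ i $ j) = (\<lambda>p \<omega>. X \<omega> $ fst p $ snd p)"
          by (auto simp: fun_eq_iff)
        then show ?thesis using X by (simp add: standard_gaussian_matrix_def)
      qed
      from indep_varsD[OF this, of UNIV "\<lambda>p. {a $ fst p $ snd p <..< b $ fst p $ snd p}"]
      show ?thesis by (simp add: emeasure_eq_measure prod_ennreal)
    qed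
    also have "\<dots> = (\<Prod>p\<in>UNIV. \<integral>\<^sup>+x. ennreal (std_normal_density x)
        * indicator {a $ fst p $ snd p <..< b $ fst p $ snd p} x \<partial>lborel)"
      by (intro prod.cong refl distributed_emeasure[OF dist]) auto
    also have "\<dots> = (\<Prod>e\<in>Basis. \<integral>\<^sup>+x. ennreal (std_normal_density x)
        * indicator {a \<bullet> e <..< b \<bullet> e} x \<partial>lborel)"
      by (simp add: basis case_prod_beta inner_axis)
    also have "\<dots> = (\<integral>\<^sup>+x. (\<Prod>e\<in>Basis. ennreal (std_normal_density (x \<bullet> e))
        * indicator {a \<bullet> e <..< b \<bullet> e} (x \<bullet> e)) \<partial>lborel)"
      by (rule nn_integral_lborel_prod[symmetric]) auto
    also have "\<dots> = (\<integral>\<^sup>+x. (\<Prod>e\<in>Basis. ennreal (std_normal_density (x \<bullet> e)))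
        * indicator (box a b) x \<partial>lborel)"
    proof (intro nn_integral_cong)
      fix x :: "real ^ 'm ^ 'n"
      have "(\<Prod>e\<in>Basis. indicator {a \<bullet> e <..< b \<bullet> e} (x \<bullet> e) :: ennreal) = indicator (box a b) x"
        by (auto simp: indicator_def mem_box prod_zero_iff intro!: prod.neutral)
      then show "(\<Prod>e\<in>Basis. ennreal (std_normal_density (x \<bullet> e)) * indicator {a \<bullet> e <..< b \<bullet> e} (x \<bullet> e))
          = (\<Prod>e\<in>Basis. ennreal (std_normal_density (x \<bullet> e))) * indicator (box a b) x"
        by (simp add: prod.distrib)
    qed
    also have "\<dots> = emeasure ?G (box a b)"
      by (simp add: std_gaussian_def emeasure_density)
    finally show ?thesis .
  qed
  let ?A = "\<lambda>n::nat. box (- (real n *\<^sub>R One)) (real n *\<^sub>R One) :: (real ^ 'm ^ 'n) set"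
  show "?D = ?G"
  proof (rule measure_eqI_generator_eq)
    show "Int_stable ?E" by (auto simp: Int_stable_def box_Int_box)
    show "?E \<subseteq> Pow UNIV" "sets ?D = sigma_sets UNIV ?E" "sets ?G = sigma_sets UNIV ?E"
      by (simp_all add: borel_eq_box)
    show "range ?A \<subseteq> ?E" "(\<Union>i. ?A i) = UNIV"
      unfolding UN_box_eq_UNIV by auto
    show "emeasure ?D (?A i) \<noteq> \<infinity>" for i
      using finite_measure.emeasure_finite[OF prob_space.finite_measure[OF prob_space_distr[OF meas]]]
      by simp
    show "emeasure ?D E = emeasure ?G E" if "E \<in> ?E" for E
      using that box by auto
  qed
qed


section \<open>Gaussian matrices have full rank\<close>

text \<open>
\<open>det (B + t I)\<close> is a polynomial in \<open>t\<close>, and it is not the zero polynomial because \<open>B + t I\<close> is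
injective as soon as \<open>t\<close> exceeds the operator norm of \<open>B\<close>.
\<close>

lemma finite_singular_shifts:
  fixes B :: "real ^ 'm ^ 'm"
  shows "finite {t. det (B + t *\<^sub>R mat 1) = 0}"
proof -
  define p where "p = (\<Sum>\<pi>\<in>{\<pi>. \<pi> permutes (UNIV :: 'm set)}. of_int (sign \<pi>) *
    (\<Prod>i\<in>UNIV. [:B $ i $ \<pi> i, mat 1 $ i $ \<pi> i:]))"
  have p: "poly p t = det (B + t *\<^sub>R mat 1)" for t
    unfolding p_def det_def by (simp add: poly_sum poly_prod)
  obtain K where K: "\<And>x. norm (B *v x) \<le> K * norm x"
    using bounded_linear.bounded[OF matrix_vector_mul_bounded_linear[of B]] by (metis mult.commute)
  \<comment> \<open>Any value above the operator norm works; the absolute value covers a negative bound \<open>K\<close>.\<close>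
  define t where "t = \<bar>K\<bar> + 1"
  have "x = 0" if "(B + t *\<^sub>R mat 1) *v x = 0" for x
  proof (rule ccontr)
    assume x: "x \<noteq> 0"
    have "(B + t *\<^sub>R mat 1) *v x = B *v x + t *\<^sub>R x"
      by (simp add: matrix_vector_mult_add_rdistrib scaleR_matrix_vector_assoc[symmetric])
    then have "B *v x = - (t *\<^sub>R x)" using that by (simp add: eq_neg_iff_add_eq_0)
    then have "t * norm x \<le> K * norm x" using K[of x] by (simp add: t_def)
    then show False using x by (simp add: t_def)
  qed
  then have "det (B + t *\<^sub>R mat 1) \<noteq> 0"
    unfolding invertible_det_nz[symmetric] invertible_left_inverse matrix_left_invertible_ker by blast
  then have "p \<noteq> 0" using p[of t] by auto
  then show ?thesis using poly_roots_finite[of p] by (simp add: p)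
qed

text \<open>
Lebesgue measure does not change when \<open>Z\<close> is replaced by \<open>Z + t P\<close>. Averaging over \<open>t \<in> [0, 1]\<close> and
exchanging the integrals reduces the claim to a single line \<open>Z + t P\<close>, along which the determinant is
\<open>det (P\<^sup>T Z + t I)\<close> and vanishes only finitely often.
\<close>

lemma AE_lborel_det_transpose_mult:
  fixes P :: "real ^ 'm ^ 'n"
  assumes P: "transpose P ** P = mat 1"
  shows "AE Z in lborel. det (transpose P ** Z) \<noteq> 0"
proof -
  define N where "N = {Z. det (transpose P ** Z) = 0}"
  have [measurable]: "(\<lambda>Z. det (transpose P ** Z)) \<in> borel_measurable borel"
    by (rule measurable_compose[OF _ borel_measurable_det]) measurable
  have [measurable]: "N \<in> sets borel"
    unfolding N_def by measurable
  have shift: "(\<integral>\<^sup>+Z. indicator N (t *\<^sub>R P + Z) \<partial>lborel) = emeasure lborel N" for t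
  proof -
    have "(\<integral>\<^sup>+Z. indicator N (t *\<^sub>R P + Z) \<partial>lborel)
        = (\<integral>\<^sup>+Z. indicator N Z \<partial>distr lborel borel ((+) (t *\<^sub>R P)))"
      by (subst nn_integral_distr) auto
    then show ?thesis by (simp add: lborel_distr_plus)
  qed
  have line: "(\<integral>\<^sup>+t. indicator {0..1} t * indicator N (t *\<^sub>R P + Z) \<partial>lborel) = 0" for Z
  proof -
    have "transpose P ** (t *\<^sub>R P + Z) = transpose P ** Z + t *\<^sub>R mat 1" for t
    proof -
      have "transpose P ** (t *\<^sub>R P) = t *\<^sub>R (transpose P ** P)"
        by (simp add: matrix_matrix_mult_def vec_eq_iff sum_distrib_left mult.left_commute)
      then show ?thesis by (simp add: matrix_add_ldistrib P add.commute)
    qed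
    then have "{t. t *\<^sub>R P + Z \<in> N} = {t. det (transpose P ** Z + t *\<^sub>R mat 1) = 0}"
      by (simp add: N_def)
    then have fin: "finite {t. t *\<^sub>R P + Z \<in> N}" using finite_singular_shifts by simp
    then have "AE t in lborel. t \<notin> {t. t *\<^sub>R P + Z \<in> N}"
      by (intro AE_not_in finite_imp_null_set_lborel)
    then have "AE t in lborel. indicator {0..1} t * indicator N (t *\<^sub>R P + Z) = (0 :: ennreal)"
      by eventually_elim simp
    then show ?thesis by (subst nn_integral_0_iff_AE) auto
  qed
  \<comment> \<open>The factor for \<open>[0, 1]\<close> has total mass 1.\<close>
  have "emeasure lborel N = (\<integral>\<^sup>+t. indicator {0..1::real} t * emeasure lborel N \<partial>lborel)"
    by (simp add: nn_integral_multc)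
  also have "\<dots> = (\<integral>\<^sup>+t. \<integral>\<^sup>+Z. indicator {0..1::real} t * indicator N (t *\<^sub>R P + Z) \<partial>lborel \<partial>lborel)"
    by (simp add: nn_integral_cmult shift)
  also have "\<dots> = (\<integral>\<^sup>+Z. \<integral>\<^sup>+t. indicator {0..1::real} t * indicator N (t *\<^sub>R P + Z) \<partial>lborel \<partial>lborel)"
    by (rule lborel_pair.Fubini'[symmetric]) measurable
  also have "\<dots> = 0" by (simp add: line)
  finally have "N \<in> null_sets lborel" by (intro null_setsI) auto
  then have "AE Z in lborel. Z \<notin> N" by (rule AE_not_in)
  then show ?thesis by (simp add: N_def)
qed

lemma AE_std_gaussian_invertible:
  fixes P :: "real ^ 'm ^ 'n"
  assumes P: "transpose P ** P = mat 1"
  shows "AE Z in (std_gaussian :: (real ^ 'm ^ 'n) measure). invertible (transpose P ** Z)"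
  unfolding std_gaussian_def
  using AE_lborel_det_transpose_mult[OF P, folded invertible_det_nz] by (subst AE_density) (auto elim!: eventually_mono)


section \<open>Haar measure on the orthogonal group\<close>

lemma measurable_haar:
  assumes "haar_orthogonal (\<mu> :: (real ^ 'm ^ 'm) measure)"
  shows "measurable \<mu> N = measurable borel N"
proof -
  have "sets \<mu> = sets borel" using assms by (simp add: haar_orthogonal_def)
  then show ?thesis by (simp cong: measurable_cong_sets)
qed

lemma haar_orthogonal_left:
  assumes \<mu>: "haar_orthogonal \<mu>" and V: "orthogonal_matrix V" and f: "f \<in> borel_measurable borel"
  shows "(\<integral>\<^sup>+U. f (V ** U) \<partial>\<mu>) = (\<integral>\<^sup>+U. f U \<partial>\<mu>)"
proof -
  have "distr \<mu> borel (\<lambda>U. V ** U) = \<mu>" using \<mu> V by (simp add: haar_orthogonal_def)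
  then have "(\<integral>\<^sup>+U. f U \<partial>\<mu>) = (\<integral>\<^sup>+U. f U \<partial>distr \<mu> borel (\<lambda>U. V ** U))" by simp
  also have "\<dots> = (\<integral>\<^sup>+U. f (V ** U) \<partial>\<mu>)"
    using f by (intro nn_integral_distr) (simp_all add: measurable_haar[OF \<mu>])
  finally show ?thesis ..
qed

text \<open>
Left invariance implies invariance under inversion: the average of \<open>f (V\<^sup>T U)\<close> over independent \<open>U\<close> and
\<open>V\<close> equals the average of \<open>f U\<close> when \<open>U\<close> is integrated first, and, since \<open>V\<^sup>T U = (U\<^sup>T V)\<^sup>T\<close>, the average
of \<open>f (V\<^sup>T)\<close> when \<open>V\<close> is integrated first.
\<close>

lemma haar_orthogonal_transpose:
  fixes \<mu> :: "(real ^ 'm ^ 'm) measure"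
  assumes \<mu>: "haar_orthogonal \<mu>" and f [measurable]: "f \<in> borel_measurable borel"
  shows "(\<integral>\<^sup>+U. f (transpose U) \<partial>\<mu>) = (\<integral>\<^sup>+U. f U \<partial>\<mu>)"
proof -
  interpret prob_space \<mu> using \<mu> by (simp add: haar_orthogonal_def)
  interpret pair_sigma_finite \<mu> \<mu> ..
  have sets [measurable_cong]: "sets \<mu> = sets borel" using \<mu> by (simp add: haar_orthogonal_def)
  have orth: "AE U in \<mu>. orthogonal_matrix U" using \<mu> by (simp add: haar_orthogonal_def)
  have "(\<integral>\<^sup>+U. f U \<partial>\<mu>) = (\<integral>\<^sup>+V. \<integral>\<^sup>+U. f U \<partial>\<mu> \<partial>\<mu>)" by (simp add: emeasure_space_1)
  also have "\<dots> = (\<integral>\<^sup>+V. \<integral>\<^sup>+U. f (transpose V ** U) \<partial>\<mu> \<partial>\<mu>)"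
    using orth
    by (intro nn_integral_cong_AE)
      (auto elim!: eventually_mono simp: haar_orthogonal_left[OF \<mu> _ f])
  also have "\<dots> = (\<integral>\<^sup>+U. \<integral>\<^sup>+V. f (transpose V ** U) \<partial>\<mu> \<partial>\<mu>)"
    by (rule Fubini') measurable
  also have "\<dots> = (\<integral>\<^sup>+U. \<integral>\<^sup>+V. f (transpose (transpose U ** V)) \<partial>\<mu> \<partial>\<mu>)"
    by (simp add: matrix_transpose_mul)
  also have "\<dots> = (\<integral>\<^sup>+U. \<integral>\<^sup>+V. f (transpose V) \<partial>\<mu> \<partial>\<mu>)"
    using orth
    by (intro nn_integral_cong_AE)
      (auto elim!: eventually_mono simp: haar_orthogonal_left[OF \<mu>, where f = "\<lambda>V. f (transpose V)"])
  also have "\<dots> = (\<integral>\<^sup>+V. f (transpose V) \<partial>\<mu>)" by (simp add: emeasure_space_1)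
  finally show ?thesis ..
qed

text \<open>
Transposition exchanges left and right multiplication.
\<close>

lemma haar_orthogonal_right:
  fixes \<mu> :: "(real ^ 'm ^ 'm) measure"
  assumes \<mu>: "haar_orthogonal \<mu>" and W: "orthogonal_matrix W"
  shows "distr \<mu> borel (\<lambda>U. U ** W) = \<mu>"
proof (rule measure_eqI)
  have sets [measurable_cong]: "sets \<mu> = sets borel" using \<mu> by (simp add: haar_orthogonal_def)
  show "sets (distr \<mu> borel (\<lambda>U. U ** W)) = sets \<mu>" by (simp add: sets)
  fix A assume "A \<in> sets (distr \<mu> borel (\<lambda>U. U ** W))"
  then have [measurable]: "A \<in> sets borel" by simp
  have "emeasure (distr \<mu> borel (\<lambda>U. U ** W)) A = (\<integral>\<^sup>+U. indicator A U \<partial>distr \<mu> borel (\<lambda>U. U ** W))"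
    by simp
  also have "\<dots> = (\<integral>\<^sup>+U. indicator A (U ** W) \<partial>\<mu>)"
    by (subst nn_integral_distr) auto
  also have "\<dots> = (\<integral>\<^sup>+U. indicator A (transpose U ** W) \<partial>\<mu>)"
    by (rule haar_orthogonal_transpose[OF \<mu>, symmetric]) measurable
  also have "\<dots> = (\<integral>\<^sup>+U. indicator A (transpose (transpose W ** U)) \<partial>\<mu>)"
    by (simp add: matrix_transpose_mul)
  also have "\<dots> = (\<integral>\<^sup>+U. indicator A (transpose U) \<partial>\<mu>)"
    using W by (intro haar_orthogonal_left[OF \<mu>, where f = "\<lambda>U. indicator A (transpose U)"]) simp_all
  also have "\<dots> = (\<integral>\<^sup>+U. indicator A U \<partial>\<mu>)"
    by (rule haar_orthogonal_transpose[OF \<mu>]) measurable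
  also have "\<dots> = emeasure \<mu> A" by (simp add: sets)
  finally show "emeasure (distr \<mu> borel (\<lambda>U. U ** W)) A = emeasure \<mu> A" .
qed

text \<open>
Gram--Schmidt orthonormalisation of the columns, in an arbitrary fixed order, as a Borel map that
commutes with rotations.
\<close>

lemma gram_schmidt_matrix:
  obtains G :: "real ^ 'n ^ 'n \<Rightarrow> real ^ 'n ^ 'n" where
    "G \<in> borel_measurable borel"
    "\<And>Z. invertible Z \<Longrightarrow> orthogonal_matrix (G Z)"
    "\<And>V Z. orthogonal_matrix V \<Longrightarrow> G (V ** Z) = V ** G Z"
proof -
  obtain idx :: "'n \<Rightarrow> nat" where idx: "inj idx"
    using finite_imp_inj_to_nat_seg[of "UNIV :: 'n set"] by auto
  have "\<exists>js. set js = {j. idx j < idx k}" for k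
    by (rule finite_list) simp
  then obtain js where js: "\<And>k. set (js k) = {j. idx j < idx k}" by metis
  define r where "r k Z = column k Z - gs_proj (map (\<lambda>j. column j Z) (js k)) (column k Z)"
    for k and Z :: "real ^ 'n ^ 'n"
  define G where "G Z = (\<chi> i k. (r k Z /\<^sub>R norm (r k Z)) $ i)" for Z
  have col: "column k (G Z) = r k Z /\<^sub>R norm (r k Z)" for k Z
    by (simp add: G_def column_def vec_eq_iff)
  show thesis
  proof
    have [measurable]: "r k \<in> borel_measurable borel" for k
    proof -
      have "(\<lambda>Z :: real ^ 'n ^ 'n. gs_proj (map (\<lambda>f. f Z) (map (\<lambda>j Z. column j Z) (js k))) (column k Z))
          \<in> borel_measurable borel"
        by (rule gs_proj_measurable) auto
      then show ?thesis unfolding r_def by (simp add: comp_def)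
    qed
    show "G \<in> borel_measurable borel"
      unfolding G_def by (intro borel_measurable_vec) simp
  next
    fix Z :: "real ^ 'n ^ 'n" assume Z: "invertible Z"
    let ?S = "\<lambda>k. span (set (map (\<lambda>j. column j Z) (js k)))"
    \<comment> \<open>A zero residual would put column \<open>k\<close> into the span of the other columns, all of which are
      orthogonal to the dual vector \<open>column k W\<close>, whereas column \<open>k\<close> itself is not.\<close>
    have nz: "r k Z \<noteq> 0" for k
    proof
      assume "r k Z = 0"
      then have "column k Z \<in> ?S k" unfolding r_def using gs_proj_in_span by (metis eq_iff_diff_eq_0)
      moreover have "?S k \<subseteq> span {column j Z |j. j \<noteq> k}"
        using js by (intro span_mono) auto
      moreover obtain W c where w: "c \<noteq> 0" "transpose Z *v column k W = c *\<^sub>R axis k 1"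
        by (rule orthogonal_matrix_with_normal[OF Z])
      ultimately have "column k W \<bullet> column k Z = 0"
        using span_other_columns_eq_orthogonal_complement[OF Z w(2,1)] by blast
      moreover have "column k W \<bullet> column k Z = (transpose Z *v column k W) \<bullet> axis k 1"
        unfolding matrix_vector_mult_axis[of Z k, symmetric]
        by (simp only: dot_lmul_matrix transpose_matrix_vector)
      ultimately show False unfolding w(2) using w(1) by (simp add: inner_axis_axis)
    qed
    have less: "r k Z \<bullet> r j Z = 0" if jk: "idx j < idx k" for j k
    proof -
      have "?S j \<subseteq> ?S k" using js jk by (intro span_mono) auto
      moreover have "column j Z \<in> ?S k" using js jk by (intro span_base) auto
      ultimately have "r j Z \<in> ?S k"
        unfolding r_def using gs_proj_in_span by (intro span_diff) blast+
      then show ?thesis unfolding r_def[of k] by (rule gs_proj_orthogonal)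
    qed
    have "orthogonal (column i (G Z)) (column j (G Z))" if "i \<noteq> j" for i j
    proof -
      have "idx i < idx j \<or> idx j < idx i" using that idx by (metis injD linorder_neqE_nat)
      then have "r i Z \<bullet> r j Z = 0" using less by (metis inner_commute)
      then show ?thesis by (simp add: orthogonal_def col)
    qed
    then show "orthogonal_matrix (G Z)"
      using nz by (simp add: orthogonal_matrix_orthonormal_columns col)
  next
    fix V Z :: "real ^ 'n ^ 'n" assume V: "orthogonal_matrix V"
    have ot: "orthogonal_transformation ((*v) V)"
      using V by (simp add: orthogonal_transformation_matrix)
    have r: "r k (V ** Z) = V *v r k Z" for k
      using gs_proj_orthogonal_transformation[OF ot, of "map (\<lambda>j. column j Z) (js k)" "column k Z"]
      by (simp add: r_def column_matrix_mult matrix_vector_mult_diff_distrib comp_def)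
    have "column k (G (V ** Z)) = column k (V ** G Z)" for k
      using orthogonal_transformation_norm[OF ot]
      by (simp add: col column_matrix_mult r matrix_vector_mult_scaleR)
    then show "G (V ** Z) = V ** G Z" by (simp add: column_def vec_eq_iff)
  qed
qed

text \<open>
Orthonormalising the columns of a square Gaussian matrix gives a random orthogonal matrix; its law is
left invariant because the Gaussian law is and Gram--Schmidt commutes with rotations. This measure on
the big orthogonal group serves to move the column space of \<open>\<Omega>\<close> around.
\<close>

lemma haar_orthogonal_exists: "\<exists>\<mu> :: (real ^ 'n ^ 'n) measure. haar_orthogonal \<mu>"
proof -
  obtain G :: "real ^ 'n ^ 'n \<Rightarrow> real ^ 'n ^ 'n" where G [measurable]: "G \<in> borel_measurable borel"
    and orth: "\<And>Z. invertible Z \<Longrightarrow> orthogonal_matrix (G Z)"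
    and equi: "\<And>V Z. orthogonal_matrix V \<Longrightarrow> G (V ** Z) = V ** G Z"
    using gram_schmidt_matrix by blast
  interpret prob_space "std_gaussian :: (real ^ 'n ^ 'n) measure" by (rule prob_space_std_gaussian)
  have "{U :: real ^ 'n ^ 'n. orthogonal_matrix U} = (\<lambda>U. transpose U ** U) -` {mat 1}"
    by (auto simp: orthogonal_matrix)
  also have "\<dots> \<in> sets borel" by (rule measurable_sets_borel[where M = borel]) auto
  finally have [measurable]: "{U :: real ^ 'n ^ 'n. orthogonal_matrix U} \<in> sets borel" .
  have "AE Z in std_gaussian. invertible (Z :: real ^ 'n ^ 'n)"
    using AE_std_gaussian_invertible[of "mat 1 :: real ^ 'n ^ 'n"] by (simp add: transpose_mat)
  then have "AE U in distr std_gaussian borel G. orthogonal_matrix U"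
    by (subst AE_distr_iff) (auto elim!: eventually_mono simp: orth)
  moreover have "distr (distr std_gaussian borel G) borel (\<lambda>U. V ** U) = distr std_gaussian borel G"
    if V: "orthogonal_matrix V" for V
  proof -
    have "distr (distr std_gaussian borel G) borel (\<lambda>U. V ** U) = distr std_gaussian borel (\<lambda>Z. G (V ** Z))"
      by (subst distr_distr) (auto simp: comp_def equi[OF V])
    also have "\<dots> = distr (distr std_gaussian borel (\<lambda>Z. V ** Z)) borel G"
      by (subst distr_distr) (auto simp: comp_def)
    finally show ?thesis by (simp add: std_gaussian_matrix_mult[OF V])
  qed
  ultimately have "haar_orthogonal (distr std_gaussian borel G)"
    by (simp add: haar_orthogonal_def prob_space_distr)
  then show ?thesis by blast
qed


section \<open>Averaging the estimators over the orthogonal group\<close>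

lemma borel_measurable_loo_trace [measurable (raw)]:
  fixes X :: "'a \<Rightarrow> real ^ 'm ^ 'n"
  assumes "X \<in> borel_measurable M"
  shows "(\<lambda>\<omega>. loo_trace A (X \<omega>) i) \<in> borel_measurable M"
  by (rule measurable_compose[OF assms loo_trace_measurable])

lemma borel_measurable_XTraceFull [measurable (raw)]:
  fixes X :: "'a \<Rightarrow> real ^ 'm ^ 'n"
  assumes [measurable]: "X \<in> borel_measurable M"
  shows "(\<lambda>\<omega>. XTraceFull A (X \<omega>)) \<in> borel_measurable M"
  unfolding XTraceFull_def by measurable

lemma borel_measurable_orth_projector [measurable (raw)]:
  fixes X :: "'a \<Rightarrow> real ^ 'm ^ 'n"
  assumes "X \<in> borel_measurable M"
  shows "(\<lambda>\<omega>. orth_projector (col_space (X \<omega>))) \<in> borel_measurable M"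
  by (rule measurable_compose[OF assms orth_projector_measurable])

lemma XTraceFull_bounded:
  fixes A :: "real ^ 'n ^ 'n"
  obtains C where "\<And>X :: real ^ 'm ^ 'n. \<bar>XTraceFull A X\<bar> \<le> C"
    "\<And>(X :: real ^ 'm ^ 'n) i. \<bar>loo_trace A X i\<bar> \<le> C"
proof -
  obtain C where C: "\<And>(X :: real ^ 'm ^ 'n) i. \<bar>loo_trace A X i\<bar> \<le> C"
    using loo_trace_bounded[of A] by metis
  have "\<bar>XTraceFull A X\<bar> \<le> C" for X :: "real ^ 'm ^ 'n"
  proof -
    have "\<bar>\<Sum>i\<in>UNIV. loo_trace A X i\<bar> \<le> (\<Sum>i\<in>(UNIV :: 'm set). C)"
      by (intro order_trans[OF sum_abs] sum_mono C)
    then show ?thesis by (simp add: XTraceFull_def abs_mult field_simps)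
  qed
  then show thesis using C that by blast
qed

lemma integral_bounded:
  assumes "prob_space M" "f \<in> borel_measurable M" "\<And>x. \<bar>f x\<bar> \<le> (C :: real)"
  shows "integrable M f" and "\<bar>LINT x|M. f x\<bar> \<le> C"
proof -
  interpret prob_space M by fact
  show int: "integrable M f" using assms(2,3) by (intro integrable_const_bound[of f C]) auto
  have "\<bar>LINT x|M. f x\<bar> \<le> (LINT x|M. \<bar>f x\<bar>)" by (rule integral_abs_bound)
  also have "\<dots> \<le> (LINT x|M. C)"
    using int assms(3) by (intro integral_mono) auto
  finally show "\<bar>LINT x|M. f x\<bar> \<le> C" by (simp add: prob_space)
qed

lemma integrable_loo:
  fixes X :: "'a \<Rightarrow> real ^ 'm ^ 'n"
  assumes M: "prob_space M" and [measurable]: "X \<in> borel_measurable M"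
  shows "integrable M (\<lambda>\<omega>. loo_trace A (X \<omega>) i)" "integrable M (\<lambda>\<omega>. XTraceFull A (X \<omega>))"
proof -
  obtain C where C: "\<And>X :: real ^ 'm ^ 'n. \<bar>XTraceFull A X\<bar> \<le> C"
    "\<And>(X :: real ^ 'm ^ 'n) i. \<bar>loo_trace A X i\<bar> \<le> C"
    by (metis XTraceFull_bounded)
  show "integrable M (\<lambda>\<omega>. loo_trace A (X \<omega>) i)" "integrable M (\<lambda>\<omega>. XTraceFull A (X \<omega>))"
    using C by (intro integral_bounded(1)[OF M, of _ C]; simp)+
qed

lemma haar_orthogonal_prob: "haar_orthogonal \<mu> \<Longrightarrow> prob_space \<mu>"
  and haar_orthogonal_sets: "haar_orthogonal \<mu> \<Longrightarrow> sets \<mu> = sets borel"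
  and haar_orthogonal_AE: "haar_orthogonal \<mu> \<Longrightarrow> AE U in \<mu>. orthogonal_matrix U"
  by (auto simp: haar_orthogonal_def)

lemma integral_haar_right:
  fixes f :: "real ^ 'm ^ 'm \<Rightarrow> real"
  assumes \<mu>: "haar_orthogonal \<mu>" and W: "orthogonal_matrix W" and [measurable]: "f \<in> borel_measurable borel"
  shows "(LINT U|\<mu>. f (U ** W)) = (LINT U|\<mu>. f U)"
proof -
  note [measurable_cong] = haar_orthogonal_sets[OF \<mu>]
  have "(LINT U|\<mu>. f U) = (LINT U|distr \<mu> borel (\<lambda>U. U ** W). f U)"
    by (simp add: haar_orthogonal_right[OF \<mu> W])
  then show ?thesis by (simp add: integral_distr)
qed

text \<open>
The common value of the three conditional expectations, as a function of an orthonormal basis of the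
column space.
\<close>

definition haar_xtrace :: "(real ^ 'm ^ 'm) measure \<Rightarrow> real ^ 'n ^ 'n \<Rightarrow> real ^ 'm ^ 'n \<Rightarrow> real"
  where "haar_xtrace \<mu> A P = (LINT U|\<mu>. XTraceFull A (P ** U))"

text \<open>
By the description through normals, omitting column \<open>i\<close> of \<open>P U R\<close> is the same as omitting column \<open>k\<close>
of \<open>P U W\<close>, where \<open>W\<close> is an orthogonal matrix that depends on \<open>R\<close>, \<open>i\<close> and \<open>k\<close> but not on \<open>U\<close>. Right
invariance then absorbs \<open>W\<close>. So, after averaging over \<open>U\<close>, neither \<open>R\<close> nor the index matters.
\<close>

lemma integral_haar_loo_trace:
  fixes \<mu> :: "(real ^ 'm ^ 'm) measure" and P :: "real ^ 'm ^ 'n"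
    and R :: "real ^ 'm ^ 'm"
  assumes \<mu>: "haar_orthogonal \<mu>" and R: "invertible R"
  shows "(LINT U|\<mu>. loo_trace A (P ** U ** R) i) = (LINT U|\<mu>. loo_trace A (P ** U) k)"
proof -
  note [measurable_cong] = haar_orthogonal_sets[OF \<mu>]
  obtain W c where W: "orthogonal_matrix W" "c \<noteq> 0" "transpose R *v column k W = c *\<^sub>R axis i 1"
    by (rule orthogonal_matrix_with_normal[OF R])
  have eq: "loo_trace A (P ** U ** R) i = loo_trace A (P ** (U ** W)) k" if U: "orthogonal_matrix U" for U
  proof -
    have "loo_trace A (P ** (U ** R)) i = loo_trace A (P ** (U ** W)) k"
    proof (rule loo_trace_normal_cong)
      show "invertible (U ** R)"
        using U R by (intro invertible_mult) (auto simp: orthogonal_matrix_def invertible_def)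
      show "orthogonal_matrix (U ** W)" using U W by (simp add: orthogonal_matrix_mul)
      have "transpose (U ** R) *v column k (U ** W) = (transpose R ** (transpose U ** U)) *v column k W"
        by (simp only: column_matrix_mult matrix_transpose_mul matrix_vector_mul_assoc matrix_mul_assoc)
      also have "\<dots> = transpose R *v column k W" using U by (simp only: orthogonal_matrix matrix_mul_rid)
      finally show "transpose (U ** R) *v column k (U ** W) = c *\<^sub>R axis i 1" using W(3) by simp
    qed (rule W(2))
    then show ?thesis by (simp add: matrix_mul_assoc)
  qed
  have "(LINT U|\<mu>. loo_trace A (P ** U ** R) i) = (LINT U|\<mu>. loo_trace A (P ** (U ** W)) k)"
    using haar_orthogonal_AE[OF \<mu>] by (intro integral_cong_AE) (auto elim!: eventually_mono simp: eq)
  also have "\<dots> = (LINT U|\<mu>. loo_trace A (P ** U) k)"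
    by (rule integral_haar_right[OF \<mu> W(1)]) measurable
  finally show ?thesis .
qed

lemma haar_xtrace_eq_sum:
  fixes \<mu> :: "(real ^ 'm ^ 'm) measure" and P :: "real ^ 'm ^ 'n"
    and R :: "real ^ 'm ^ 'm"
  assumes \<mu>: "haar_orthogonal \<mu>"
  shows "(LINT U|\<mu>. XTraceFull A (P ** U ** R))
      = 1 / real CARD('m) * (\<Sum>i\<in>(UNIV :: 'm set). LINT U|\<mu>. loo_trace A (P ** U ** R) i)"
proof -
  note [measurable_cong] = haar_orthogonal_sets[OF \<mu>]
  have "integrable \<mu> (\<lambda>U. loo_trace A (P ** U ** R) i)" for i
    by (intro integrable_loo haar_orthogonal_prob[OF \<mu>]) measurable
  then show ?thesis unfolding XTraceFull_def by simp
qed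

lemma integral_haar_XTraceFull:
  fixes \<mu> :: "(real ^ 'm ^ 'm) measure" and P :: "real ^ 'm ^ 'n"
    and R :: "real ^ 'm ^ 'm"
  assumes \<mu>: "haar_orthogonal \<mu>" and R: "invertible R"
  shows "(LINT U|\<mu>. XTraceFull A (P ** U ** R)) = haar_xtrace \<mu> A P"
proof -
  have "(LINT U|\<mu>. loo_trace A (P ** U ** R) i) = (LINT U|\<mu>. loo_trace A (P ** U) i)" for i
    by (rule integral_haar_loo_trace[OF \<mu> R])
  then show ?thesis
    using haar_xtrace_eq_sum[OF \<mu>, of A P R] haar_xtrace_eq_sum[OF \<mu>, of A P "mat 1"]
    by (simp add: haar_xtrace_def)
qed

lemma integral_haar_loo_trace_eq_haar_xtrace:
  fixes \<mu> :: "(real ^ 'm ^ 'm) measure" and P :: "real ^ 'm ^ 'n"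
  assumes \<mu>: "haar_orthogonal \<mu>"
  shows "(LINT U|\<mu>. loo_trace A (P ** U) k) = haar_xtrace \<mu> A P"
proof -
  have "invertible (mat 1 :: real ^ 'm ^ 'm)" by (auto simp: invertible_def)
  then have "(LINT U|\<mu>. loo_trace A (P ** U) i) = (LINT U|\<mu>. loo_trace A (P ** U) k)" for i
    using integral_haar_loo_trace[OF \<mu>, of "mat 1" A P i k] by simp
  then have "(\<Sum>i\<in>UNIV. LINT U|\<mu>. loo_trace A (P ** U) i)
      = (\<Sum>i\<in>(UNIV :: 'm set). LINT U|\<mu>. loo_trace A (P ** U) k)"
    by (intro sum.cong refl)
  then show ?thesis
    using haar_xtrace_eq_sum[OF \<mu>, of A P "mat 1"] by (simp add: haar_xtrace_def)
qed

lemma borel_measurable_haar_xtrace: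
  assumes \<mu>: "haar_orthogonal \<mu>"
  shows "haar_xtrace \<mu> A \<in> borel_measurable borel"
proof -
  note [measurable_cong] = haar_orthogonal_sets[OF \<mu>]
  interpret prob_space \<mu> by (rule haar_orthogonal_prob[OF \<mu>])
  have "(\<lambda>P. LINT U|\<mu>. XTraceFull A (P ** U)) \<in> borel_measurable borel"
    by measurable
  then show ?thesis by (simp add: haar_xtrace_def[abs_def])
qed

text \<open>
Averaging over an auxiliary variable \<open>u\<close> that does not influence the integral, followed by an exchange
of the integrals. It introduces an independent random rotation into an expectation.
\<close>

lemma integral_eq_iterated_average:
  fixes F :: "'a \<Rightarrow> 'b \<Rightarrow> real"
  assumes "prob_space \<mu>" "prob_space \<nu>"
    and [measurable]: "case_prod F \<in> borel_measurable (\<mu> \<Otimes>\<^sub>M \<nu>)"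
    and bound: "\<And>u x. \<bar>F u x\<bar> \<le> C"
    and const: "AE u in \<mu>. (LINT x|\<nu>. F u x) = c"
  shows "c = (LINT x|\<nu>. LINT u|\<mu>. F u x)"
proof -
  interpret \<mu>: prob_space \<mu> by fact
  interpret \<nu>: prob_space \<nu> by fact
  interpret P: pair_prob_space \<mu> \<nu> ..
  have "integrable (\<mu> \<Otimes>\<^sub>M \<nu>) (case_prod F)"
    using bound by (intro integral_bounded(1)[of _ _ C] P.prob_space_axioms) auto
  then have "(LINT x|\<nu>. LINT u|\<mu>. F u x) = (LINT u|\<mu>. LINT x|\<nu>. F u x)"
    by (rule P.Fubini_integral)
  also have "\<dots> = (LINT u|\<mu>. c)"
    using const by (intro integral_cong_AE) auto
  finally show ?thesis by (simp add: \<mu>.prob_space)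
qed

text \<open>
The average depends on \<open>P\<close> only through the projector \<open>P P\<^sup>T\<close>, and measurably so. To see both at once it
is rewritten as a Gaussian average: for a Gaussian matrix \<open>X\<close> the matrix \<open>P P\<^sup>T X = P (P\<^sup>T X)\<close> has
the column space of \<open>P\<close> and almost surely invertible coordinates \<open>P\<^sup>T X\<close>, whose law is invariant under
rotation. The average of \<open>XTraceFull\<close> over \<open>P P\<^sup>T X\<close> is a formula in \<open>P P\<^sup>T\<close> alone, and inserting a Haar
rotation \<open>U\<close> of the coordinates shows that it equals the Haar average.
\<close>

lemma haar_xtrace_projector:
  fixes \<mu> :: "(real ^ 'm ^ 'm) measure" and A :: "real ^ 'n ^ 'n"
  assumes \<mu>: "haar_orthogonal \<mu>"
  obtains H :: "real ^ 'n ^ 'n \<Rightarrow> real" and C where "H \<in> borel_measurable borel" "\<And>Y. \<bar>H Y\<bar> \<le> C"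
    "\<And>P :: real ^ 'm ^ 'n. transpose P ** P = mat 1 \<Longrightarrow> H (P ** transpose P) = haar_xtrace \<mu> A P"
proof -
  note [measurable_cong] = haar_orthogonal_sets[OF \<mu>]
  let ?\<gamma> = "std_gaussian :: (real ^ 'm ^ 'n) measure"
  interpret G: prob_space ?\<gamma> by (rule prob_space_std_gaussian)
  define H where "H Y = (LINT X|?\<gamma>. XTraceFull A (Y ** X))" for Y :: "real ^ 'n ^ 'n"
  obtain C where C: "\<And>X :: real ^ 'm ^ 'n. \<bar>XTraceFull A X\<bar> \<le> C"
    by (metis XTraceFull_bounded)
  show thesis
  proof
    have "(\<lambda>Y. LINT X|?\<gamma>. XTraceFull A (Y ** X)) \<in> borel_measurable borel"
      by measurable
    then show "H \<in> borel_measurable borel" by (simp add: H_def[abs_def])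
    show "\<bar>H Y\<bar> \<le> C" for Y
      unfolding H_def using C by (intro integral_bounded(2) G.prob_space_axioms) auto
  next
    fix P :: "real ^ 'm ^ 'n" assume P: "transpose P ** P = mat 1"
    have "H (P ** transpose P) = (LINT X|?\<gamma>. LINT U|\<mu>. XTraceFull A (P ** U ** (transpose P ** X)))"
    proof (rule integral_eq_iterated_average)
      show "prob_space \<mu>" by (rule haar_orthogonal_prob[OF \<mu>])
      show "AE U in \<mu>. (LINT X|?\<gamma>. XTraceFull A (P ** U ** (transpose P ** X))) = H (P ** transpose P)"
        using haar_orthogonal_AE[OF \<mu>]
      proof eventually_elim
        case (elim U)
        then obtain V where V: "orthogonal_matrix V" "transpose P ** V = U ** transpose P"
          by (metis orthogonal_matrix_extends_rotation[OF P])
        have "H (P ** transpose P)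
            = (LINT X|distr ?\<gamma> borel (\<lambda>X. V ** X). XTraceFull A (P ** transpose P ** X))"
          by (simp add: H_def std_gaussian_matrix_mult[OF V(1)])
        also have "\<dots> = (LINT X|?\<gamma>. XTraceFull A (P ** transpose P ** (V ** X)))"
          by (rule integral_distr) measurable
        also have "\<dots> = (LINT X|?\<gamma>. XTraceFull A (P ** U ** (transpose P ** X)))"
        proof -
          have "P ** transpose P ** (V ** X) = P ** U ** (transpose P ** X)" for X :: "real ^ 'm ^ 'n"
            by (metis V(2) matrix_mul_assoc)
          then show ?thesis by simp
        qed
        finally show ?case ..
      qed
    qed (use C in \<open>auto intro: G.prob_space_axioms\<close>)
    also have "\<dots> = (LINT X|?\<gamma>. haar_xtrace \<mu> A P)"
      using AE_std_gaussian_invertible[OF P]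
    proof (intro integral_cong_AE)
      interpret prob_space \<mu> by (rule haar_orthogonal_prob[OF \<mu>])
      show "(\<lambda>X. LINT U|\<mu>. XTraceFull A (P ** U ** (transpose P ** X))) \<in> borel_measurable ?\<gamma>"
        by measurable
    qed (auto elim!: eventually_mono simp: integral_haar_XTraceFull[OF \<mu>])
    finally show "H (P ** transpose P) = haar_xtrace \<mu> A P" using G.prob_space by simp
  qed
qed

lemma orthonormal_columns_rotated:
  fixes P :: "real ^ 'm ^ 'n"
  assumes "transpose P ** P = mat 1" "orthogonal_matrix V"
  shows "transpose (V ** P) ** (V ** P) = mat 1"
proof -
  have "transpose (V ** P) ** (V ** P) = transpose P ** (transpose V ** V) ** P"
    by (simp add: matrix_transpose_mul matrix_mul_assoc)
  then show ?thesis using assms by (simp add: orthogonal_matrix)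
qed

text \<open>
This is the conditional law of \<open>\<Omega>\<close> given its column space, in integrated form. The law of \<open>\<Omega>\<close> does not
change under a Haar-distributed rotation \<open>V\<close> of the big space, so it suffices to average over \<open>V\<close> with
\<open>\<Omega> = P R\<close> held fixed. A rotation within the column space of \<open>P\<close> can be absorbed into \<open>V\<close> by right invariance; it
replaces \<open>V P R\<close> by \<open>V P U R\<close> and leaves the column space, that of \<open>V P\<close>, alone. Averaging over \<open>U\<close> turns
\<open>XTraceFull\<close> into the Haar average for \<open>V P\<close>, which is a function of the projector.
\<close>

lemma integral_XTraceFull_on_projector_event:
  fixes \<Omega> Q :: "'a \<Rightarrow> real ^ 'm ^ 'n" and A :: "real ^ 'n ^ 'n"
  assumes M: "prob_space M" and [measurable]: "\<Omega> \<in> borel_measurable M"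
    and law: "distr M borel \<Omega> = std_gaussian"
    and Q: "AE \<omega> in M. transpose (Q \<omega>) ** Q \<omega> = mat 1 \<and> col_space (Q \<omega>) = col_space (\<Omega> \<omega>)"
    and \<mu>: "haar_orthogonal \<mu>"
    and H [measurable]: "H \<in> borel_measurable borel" and HC: "\<And>Y. \<bar>H Y\<bar> \<le> C"
    and HP: "\<And>P :: real ^ 'm ^ 'n. transpose P ** P = mat 1 \<Longrightarrow> H (P ** transpose P) = haar_xtrace \<mu> A P"
    and B [measurable]: "B \<in> sets borel"
  shows "(LINT \<omega>|M. indicator B (orth_projector (col_space (\<Omega> \<omega>))) * XTraceFull A (\<Omega> \<omega>))
    = (LINT \<omega>|M. indicator B (orth_projector (col_space (\<Omega> \<omega>))) * H (orth_projector (col_space (\<Omega> \<omega>))))"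
proof -
  interpret M: prob_space M by fact
  obtain \<eta> :: "(real ^ 'n ^ 'n) measure" where \<eta>: "haar_orthogonal \<eta>"
    using haar_orthogonal_exists by blast
  interpret \<eta>: prob_space \<eta> by (rule haar_orthogonal_prob[OF \<eta>])
  interpret \<mu>: prob_space \<mu> by (rule haar_orthogonal_prob[OF \<mu>])
  note [measurable_cong] = haar_orthogonal_sets[OF \<mu>] haar_orthogonal_sets[OF \<eta>]
  note [measurable] = borel_measurable_haar_xtrace[OF \<mu>]
  define \<pi> where "\<pi> X = orth_projector (col_space X)" for X :: "real ^ 'm ^ 'n"
  have [measurable]: "\<pi> \<in> borel_measurable borel"
    unfolding \<pi>_def by (rule orth_projector_measurable)
  obtain D where D: "\<And>X :: real ^ 'm ^ 'n. \<bar>XTraceFull A X\<bar> \<le> D"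
    by (metis XTraceFull_bounded)
  have ind: "\<bar>indicator B y * r\<bar> \<le> \<bar>r\<bar>" for y and r :: real
    by (simp add: indicator_def)
  \<comment> \<open>An independent Haar rotation of the whole space can be inserted in front of \<open>\<Omega>\<close>.\<close>
  have rotate: "(LINT \<omega>|M. K (\<Omega> \<omega>)) = (LINT \<omega>|M. LINT V|\<eta>. K (V ** \<Omega> \<omega>))"
    if [measurable]: "K \<in> borel_measurable borel" and K: "\<And>X. \<bar>K X\<bar> \<le> E" for K and E :: real
  proof (rule integral_eq_iterated_average)
    show "AE V in \<eta>. (LINT \<omega>|M. K (V ** \<Omega> \<omega>)) = (LINT \<omega>|M. K (\<Omega> \<omega>))"
      using haar_orthogonal_AE[OF \<eta>]
    proof eventually_elim
      case (elim V)
      have "(LINT \<omega>|M. K (V ** \<Omega> \<omega>)) = (LINT X|distr (distr M borel \<Omega>) borel (\<lambda>X. V ** X). K X)"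
        by (simp add: integral_distr)
      also have "\<dots> = (LINT X|distr M borel \<Omega>. K X)"
        by (simp add: law std_gaussian_matrix_mult[OF elim])
      finally show ?case by (simp add: integral_distr)
    qed
  qed (use K in \<open>auto intro: \<eta>.prob_space_axioms M.prob_space_axioms\<close>)
  \<comment> \<open>With \<open>\<Omega>\<close> frozen, both sides become the average of the Haar averages for \<open>V P\<close>.\<close>
  have fibre: "(LINT V|\<eta>. indicator B (\<pi> (V ** \<Omega> \<omega>)) * XTraceFull A (V ** \<Omega> \<omega>))
      = (LINT V|\<eta>. indicator B (\<pi> (V ** \<Omega> \<omega>)) * H (\<pi> (V ** \<Omega> \<omega>)))"
    if "transpose (Q \<omega>) ** Q \<omega> = mat 1 \<and> col_space (Q \<omega>) = col_space (\<Omega> \<omega>)" for \<omega>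
  proof -
    define P where "P = Q \<omega>"
    define R where "R = transpose P ** \<Omega> \<omega>"
    have P: "transpose P ** P = mat 1" and PR: "\<Omega> \<omega> = P ** R" and R: "invertible R"
      using factor_through_orthonormal_columns[of P "\<Omega> \<omega>"] that by (auto simp: P_def R_def)
    have proj: "\<pi> (V ** P ** S) = \<pi> (V ** P)" if "invertible S" for V S
      using that by (simp add: \<pi>_def col_space_mult_invertible)
    have "(LINT V|\<eta>. indicator B (\<pi> (V ** \<Omega> \<omega>)) * XTraceFull A (V ** \<Omega> \<omega>))
        = (LINT V|\<eta>. LINT U|\<mu>. indicator B (\<pi> (V ** P)) * XTraceFull A (V ** P ** U ** R))"
    proof (rule integral_eq_iterated_average)
      show "AE U in \<mu>. (LINT V|\<eta>. indicator B (\<pi> (V ** P)) * XTraceFull A (V ** P ** U ** R))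
          = (LINT V|\<eta>. indicator B (\<pi> (V ** \<Omega> \<omega>)) * XTraceFull A (V ** \<Omega> \<omega>))"
        using haar_orthogonal_AE[OF \<mu>]
      proof eventually_elim
        case (elim U)
        \<comment> \<open>\<open>W\<close> rotates the column space of \<open>P\<close> within itself and is absorbed by the law of \<open>V\<close>.\<close>
        then obtain W where W: "orthogonal_matrix W" "W ** P = P ** U"
          by (metis orthogonal_matrix_extends_rotation[OF P])
        have UR: "invertible (U ** R)"
          using elim R by (intro invertible_mult) (auto simp: orthogonal_matrix_def invertible_def)
        have X: "V ** W ** \<Omega> \<omega> = V ** P ** (U ** R)" for V
          by (metis PR W(2) matrix_mul_assoc)
        have "(LINT V|\<eta>. indicator B (\<pi> (V ** P)) * XTraceFull A (V ** P ** U ** R))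
            = (LINT V|\<eta>. indicator B (\<pi> (V ** W ** \<Omega> \<omega>)) * XTraceFull A (V ** W ** \<Omega> \<omega>))"
          unfolding X proj[OF UR] by (simp add: matrix_mul_assoc)
        also have "\<dots> = (LINT V|\<eta>. indicator B (\<pi> (V ** \<Omega> \<omega>)) * XTraceFull A (V ** \<Omega> \<omega>))"
          by (rule integral_haar_right[OF \<eta> W(1),
                where f = "\<lambda>V. indicator B (\<pi> (V ** \<Omega> \<omega>)) * XTraceFull A (V ** \<Omega> \<omega>)"]) measurable
        finally show ?case .
      qed
      show "\<bar>indicator B (\<pi> (V ** P)) * XTraceFull A (V ** P ** U ** R)\<bar> \<le> D" for U V
        using ind D order_trans by blast
    qed (auto intro: \<eta>.prob_space_axioms \<mu>.prob_space_axioms)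
    also have "\<dots> = (LINT V|\<eta>. indicator B (\<pi> (V ** P)) * haar_xtrace \<mu> A (V ** P))"
      by (simp add: integral_haar_XTraceFull[OF \<mu> R])
    also have "\<dots> = (LINT V|\<eta>. indicator B (\<pi> (V ** \<Omega> \<omega>)) * H (\<pi> (V ** \<Omega> \<omega>)))"
    proof (rule integral_cong_AE)
      show "AE V in \<eta>. indicator B (\<pi> (V ** P)) * haar_xtrace \<mu> A (V ** P)
          = indicator B (\<pi> (V ** \<Omega> \<omega>)) * H (\<pi> (V ** \<Omega> \<omega>))"
        using haar_orthogonal_AE[OF \<eta>]
      proof eventually_elim
        case (elim V)
        have VP: "transpose (V ** P) ** (V ** P) = mat 1"
          by (rule orthonormal_columns_rotated[OF P elim])
        have "\<pi> (V ** \<Omega> \<omega>) = \<pi> (V ** P)"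
          using proj[OF R, of V] by (simp add: PR matrix_mul_assoc)
        moreover have "H (\<pi> (V ** P)) = haar_xtrace \<mu> A (V ** P)"
          by (simp add: \<pi>_def orth_projector_orthonormal_columns[OF VP] HP[OF VP])
        ultimately show ?case by simp
      qed
    qed measurable
    finally show ?thesis .
  qed
  have "(LINT \<omega>|M. indicator B (\<pi> (\<Omega> \<omega>)) * XTraceFull A (\<Omega> \<omega>))
      = (LINT \<omega>|M. LINT V|\<eta>. indicator B (\<pi> (V ** \<Omega> \<omega>)) * XTraceFull A (V ** \<Omega> \<omega>))"
    by (rule rotate[of "\<lambda>X. indicator B (\<pi> X) * XTraceFull A X" D], measurable)
      (use ind D order_trans in blast)
  also have "\<dots> = (LINT \<omega>|M. LINT V|\<eta>. indicator B (\<pi> (V ** \<Omega> \<omega>)) * H (\<pi> (V ** \<Omega> \<omega>)))"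
  proof (rule integral_cong_AE)
    show "AE \<omega> in M. (LINT V|\<eta>. indicator B (\<pi> (V ** \<Omega> \<omega>)) * XTraceFull A (V ** \<Omega> \<omega>))
        = (LINT V|\<eta>. indicator B (\<pi> (V ** \<Omega> \<omega>)) * H (\<pi> (V ** \<Omega> \<omega>)))"
      using Q by eventually_elim (rule fibre)
  qed measurable
  also have "\<dots> = (LINT \<omega>|M. indicator B (\<pi> (\<Omega> \<omega>)) * H (\<pi> (\<Omega> \<omega>)))"
    by (rule rotate[of "\<lambda>X. indicator B (\<pi> X) * H (\<pi> X)" C, symmetric], measurable)
      (use ind HC order_trans in blast)
  finally show ?thesis by (simp add: \<pi>_def)
qed


section \<open>Conditional expectations\<close>

text \<open>
A function of \<open>X\<close> is the conditional expectation given \<open>X\<close> once it has the right integral over every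
event that \<open>X\<close> determines.
\<close>

lemma cond_exp_given_eqI:
  fixes X :: "'a \<Rightarrow> 'b::topological_space" and g :: "'b \<Rightarrow> real"
  assumes M: "prob_space M" and X [measurable]: "X \<in> borel_measurable M"
    and g [measurable]: "g \<in> borel_measurable borel"
    and int: "integrable M f" "integrable M (\<lambda>\<omega>. g (X \<omega>))"
    and eq: "\<And>B. B \<in> sets borel \<Longrightarrow>
      (LINT \<omega>|M. indicator B (X \<omega>) * f \<omega>) = (LINT \<omega>|M. indicator B (X \<omega>) * g (X \<omega>))"
  shows "AE \<omega> in M. cond_exp_given M X f \<omega> = g (X \<omega>)"
proof -
  let ?F = "vimage_algebra (space M) X borel"
  interpret prob_space M by fact
  have sets: "sets ?F = {X -` B \<inter> space M |B. B \<in> sets borel}"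
    by (rule sets_vimage_algebra2) simp
  interpret finite_measure_subalgebra M ?F
    by unfold_locales (auto simp: subalgebra_def sets)
  show ?thesis
    unfolding cond_exp_given_def
  proof (rule real_cond_exp_charact)
    fix S assume "S \<in> sets ?F"
    then obtain B where B: "B \<in> sets borel" "S = X -` B \<inter> space M" by (auto simp: sets)
    have *: "(LINT \<omega>:S|M. h \<omega>) = (LINT \<omega>|M. indicator B (X \<omega>) * h \<omega>)" for h :: "'a \<Rightarrow> real"
      unfolding set_lebesgue_integral_def
      by (intro Bochner_Integration.integral_cong) (auto simp: B(2) indicator_def)
    show "(LINT \<omega>:S|M. f \<omega>) = (LINT \<omega>:S|M. g (X \<omega>))"
      unfolding * by (rule eq[OF B(1)])
  next
    show "(\<lambda>\<omega>. g (X \<omega>)) \<in> borel_measurable ?F"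
      by (rule measurable_compose[OF measurable_vimage_algebra1 g]) simp
  qed (rule int)+
qed

lemma distr_independent_pair:
  fixes X :: "'a \<Rightarrow> 'b::euclidean_space" and Y :: "'a \<Rightarrow> 'c::euclidean_space"
    and Z :: "'a \<Rightarrow> 'd::euclidean_space"
  assumes M: "prob_space M" and [measurable]: "X \<in> borel_measurable M" "Y \<in> borel_measurable M"
    and ind: "independent_rvs M (\<lambda>\<omega>. (Z \<omega>, X \<omega>)) Y"
  shows "distr M borel X \<Otimes>\<^sub>M distr M borel Y = distr M (borel \<Otimes>\<^sub>M borel) (\<lambda>\<omega>. (X \<omega>, Y \<omega>))"
proof (rule pair_measure_eqI)
  interpret prob_space M by fact
  show "sigma_finite_measure (distr M borel X)" "sigma_finite_measure (distr M borel Y)"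
    by (intro prob_space_imp_sigma_finite prob_space_distr; simp)+
  show "sets (distr M borel X \<Otimes>\<^sub>M distr M borel Y) = sets (distr M (borel \<Otimes>\<^sub>M borel) (\<lambda>\<omega>. (X \<omega>, Y \<omega>)))"
    by (simp cong: sets_pair_measure_cong)
  fix B C assume "B \<in> sets (distr M borel X)" "C \<in> sets (distr M borel Y)"
  then have [measurable]: "B \<in> sets borel" "C \<in> sets borel" by auto
  have "UNIV \<times> B \<in> sets (borel :: ('d \<times> 'b) measure)"
    unfolding borel_prod[symmetric] by measurable
  then have "X -` B \<inter> space M \<in> sets (vimage_algebra (space M) (\<lambda>\<omega>. (Z \<omega>, X \<omega>)) borel)"
    using in_vimage_algebra[of "UNIV \<times> B" borel "\<lambda>\<omega>. (Z \<omega>, X \<omega>)" "space M"]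
    by (simp add: vimage_def)
  moreover have "Y -` C \<inter> space M \<in> sets (vimage_algebra (space M) Y borel)"
    by (rule in_vimage_algebra) measurable
  ultimately have "prob ((X -` B \<inter> space M) \<inter> (Y -` C \<inter> space M))
      = prob (X -` B \<inter> space M) * prob (Y -` C \<inter> space M)"
    by (rule indep_setD[OF ind[unfolded independent_rvs_def]])
  moreover have "(\<lambda>\<omega>. (X \<omega>, Y \<omega>)) -` (B \<times> C) \<inter> space M = (X -` B \<inter> space M) \<inter> (Y -` C \<inter> space M)"
    by auto
  ultimately show "emeasure (distr M borel X) B * emeasure (distr M borel Y) C
      = emeasure (distr M (borel \<Otimes>\<^sub>M borel) (\<lambda>\<omega>. (X \<omega>, Y \<omega>))) (B \<times> C)"
    by (simp add: emeasure_distr emeasure_eq_measure ennreal_mult)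
qed

lemma integral_independent:
  fixes X :: "'a \<Rightarrow> 'b::euclidean_space" and Y :: "'a \<Rightarrow> 'c::euclidean_space"
    and Z :: "'a \<Rightarrow> 'd::euclidean_space" and f :: "'b \<Rightarrow> 'c \<Rightarrow> real"
  assumes M: "prob_space M" and X [measurable]: "X \<in> borel_measurable M"
    and Y [measurable]: "Y \<in> borel_measurable M"
    and ind: "independent_rvs M (\<lambda>\<omega>. (Z \<omega>, X \<omega>)) Y"
    and f [measurable]: "case_prod f \<in> borel_measurable (borel \<Otimes>\<^sub>M borel)" and bound: "\<And>x y. \<bar>f x y\<bar> \<le> C"
  shows "(LINT \<omega>|M. f (X \<omega>) (Y \<omega>)) = (LINT \<omega>|M. LINT y|distr M borel Y. f (X \<omega>) y)"
proof -
  interpret prob_space M by fact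
  let ?X = "distr M borel X" and ?Y = "distr M borel Y"
  interpret X: prob_space ?X by (rule prob_space_distr) simp
  interpret Y: prob_space ?Y by (rule prob_space_distr) simp
  interpret P: pair_prob_space ?X ?Y ..
  have [measurable]: "case_prod f \<in> borel_measurable (?X \<Otimes>\<^sub>M ?Y)"
    using f by (simp cong: measurable_cong_sets)
  have int: "integrable (?X \<Otimes>\<^sub>M ?Y) (case_prod f)"
    using bound by (intro integral_bounded(1)[of _ _ C] P.prob_space_axioms) auto
  have "(LINT \<omega>|M. f (X \<omega>) (Y \<omega>)) = integral\<^sup>L (distr M (borel \<Otimes>\<^sub>M borel) (\<lambda>\<omega>. (X \<omega>, Y \<omega>))) (case_prod f)"
    by (simp add: integral_distr)
  also have "\<dots> = integral\<^sup>L (?X \<Otimes>\<^sub>M ?Y) (case_prod f)"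
    by (simp add: distr_independent_pair[OF M X Y ind])
  also have "\<dots> = (LINT x|?X. LINT y|?Y. f x y)"
    using P.integral_fst'[OF int] by simp
  also have "\<dots> = (LINT \<omega>|M. LINT y|?Y. f (X \<omega>) y)"
  proof (rule integral_distr)
    show "(\<lambda>x. LINT y|?Y. f x y) \<in> borel_measurable borel"
      using f by (intro Y.borel_measurable_lebesgue_integral) (simp cong: measurable_cong_sets)
  qed measurable
  finally show ?thesis .
qed

theorem theorem3p5:
  fixes M :: "'a measure"
    and A :: "real ^ 'n ^ 'n"
    and \<Omega> :: "'a \<Rightarrow> real ^ ('m::{finite,linorder}) ^ 'n"
    and Q :: "'a \<Rightarrow> real ^ ('m::{finite,linorder}) ^ 'n"
    and U :: "'a \<Rightarrow> real ^ ('m::{finite,linorder}) ^ ('m::{finite,linorder})"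
  assumes "prob_space M"
    and "CARD('m) \<le> CARD('n)"
    and "standard_gaussian_matrix M \<Omega>"
    and "Q \<in> borel_measurable M"
    and "AE \<omega> in M. transpose (Q \<omega>) ** Q \<omega> = mat 1 \<and> col_space (Q \<omega>) = col_space (\<Omega> \<omega>)"
    and "U \<in> borel_measurable M"
    and "haar_orthogonal (distr M borel U)"
    and "independent_rvs M (\<lambda>\<omega>. (\<Omega> \<omega>, Q \<omega>)) U"
  shows "integrable M (\<lambda>\<omega>. XTraceFull A (\<Omega> \<omega>))
    \<and> integrable M (\<lambda>\<omega>. LeaveOneOutFull A (Q \<omega> ** U \<omega>))
    \<and> integrable M (\<lambda>\<omega>. XTraceFull A (Q \<omega> ** U \<omega>))
    \<and> (\<lambda>\<omega>. orth_projector (col_space (\<Omega> \<omega>))) \<in> borel_measurable M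
    \<and> (AE \<omega> in M.
         cond_exp_given M (\<lambda>\<omega>. orth_projector (col_space (\<Omega> \<omega>))) (\<lambda>\<omega>. XTraceFull A (\<Omega> \<omega>)) \<omega>
           = cond_exp_given M Q (\<lambda>\<omega>. LeaveOneOutFull A (Q \<omega> ** U \<omega>)) \<omega>
       \<and> cond_exp_given M Q (\<lambda>\<omega>. LeaveOneOutFull A (Q \<omega> ** U \<omega>)) \<omega>
           = cond_exp_given M Q (\<lambda>\<omega>. XTraceFull A (Q \<omega> ** U \<omega>)) \<omega>)
    \<and> (\<forall>(P :: real ^ ('m::{finite,linorder}) ^ 'n) V W.
         transpose P ** P = mat 1 \<and> orthogonal_matrix V \<and> orthogonal_matrix W
           \<and> column (Max UNIV) V = column (Max UNIV) W
         \<longrightarrow> LeaveOneOutFull A (P ** V) = LeaveOneOutFull A (P ** W))"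
proof -
  define \<mu> where "\<mu> = distr M borel U"
  interpret prob_space M by fact
  have \<mu>: "haar_orthogonal \<mu>" using assms(7) by (simp add: \<mu>_def)
  interpret \<mu>: prob_space \<mu> by (rule haar_orthogonal_prob[OF \<mu>])
  note [measurable] = assms(4,6) distr_standard_gaussian_matrix(1)[OF assms(1,3)]
    borel_measurable_haar_xtrace[OF \<mu>]
  obtain C where C: "\<And>X :: real ^ ('m::{finite,linorder}) ^ 'n. \<bar>XTraceFull A X\<bar> \<le> C"
    "\<And>(X :: real ^ ('m::{finite,linorder}) ^ 'n) i. \<bar>loo_trace A X i\<bar> \<le> C"
    by (metis XTraceFull_bounded)
  obtain H :: "real ^ 'n ^ 'n \<Rightarrow> real" and D where H [measurable]: "H \<in> borel_measurable borel"
    and HD: "\<And>Y. \<bar>H Y\<bar> \<le> D"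
    and HP: "\<And>P :: real ^ ('m::{finite,linorder}) ^ 'n. transpose P ** P = mat 1 \<Longrightarrow> H (P ** transpose P) = haar_xtrace \<mu> A P"
    using haar_xtrace_projector[OF \<mu>, of A] by metis
  let ?\<pi> = "\<lambda>\<omega>. orth_projector (col_space (\<Omega> \<omega>))"
  have int: "integrable M (\<lambda>\<omega>. XTraceFull A (\<Omega> \<omega>))"
    "integrable M (\<lambda>\<omega>. LeaveOneOutFull A (Q \<omega> ** U \<omega>))"
    "integrable M (\<lambda>\<omega>. XTraceFull A (Q \<omega> ** U \<omega>))"
    unfolding LeaveOneOutFull_def by (intro integrable_loo assms(1); measurable)+
  have haar_bound: "\<bar>haar_xtrace \<mu> A P\<bar> \<le> C" for P :: "real ^ ('m::{finite,linorder}) ^ 'n"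
  proof -
    note [measurable_cong] = haar_orthogonal_sets[OF \<mu>]
    show ?thesis
      unfolding haar_xtrace_def using C by (intro integral_bounded(2) \<mu>.prob_space_axioms) auto
  qed
  \<comment> \<open>Since \<open>U\<close> is independent of \<open>Q\<close>, conditioning on \<open>Q\<close> freezes \<open>Q\<close> and integrates over \<open>U\<close>.\<close>
  have rotated: "AE \<omega> in M. cond_exp_given M Q (\<lambda>\<omega>. \<phi> (Q \<omega> ** U \<omega>)) \<omega> = haar_xtrace \<mu> A (Q \<omega>)"
    if [measurable]: "\<phi> \<in> borel_measurable borel" and bound: "\<And>X. \<bar>\<phi> X\<bar> \<le> C"
      and avg: "\<And>P. (LINT V|\<mu>. \<phi> (P ** V)) = haar_xtrace \<mu> A P" for \<phi> :: "real ^ ('m::{finite,linorder}) ^ 'n \<Rightarrow> real"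
  proof (rule cond_exp_given_eqI)
    show "integrable M (\<lambda>\<omega>. \<phi> (Q \<omega> ** U \<omega>))" "integrable M (\<lambda>\<omega>. haar_xtrace \<mu> A (Q \<omega>))"
      using bound haar_bound by (intro integral_bounded(1)[OF assms(1), of _ C]; simp)+
    fix B :: "(real ^ ('m::{finite,linorder}) ^ 'n) set" assume [measurable]: "B \<in> sets borel"
    have "(LINT \<omega>|M. indicator B (Q \<omega>) * \<phi> (Q \<omega> ** U \<omega>))
        = (LINT \<omega>|M. LINT V|\<mu>. indicator B (Q \<omega>) * \<phi> (Q \<omega> ** V))"
      unfolding \<mu>_def
    proof (rule integral_independent[OF assms(1,4,6,8)])
      show "\<bar>indicator B P * \<phi> (P ** V)\<bar> \<le> C" for P and V :: "real ^ ('m::{finite,linorder}) ^ ('m::{finite,linorder})"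
        using bound[of "P ** V"] by (auto simp: indicator_def)
    qed measurable
    then show "(LINT \<omega>|M. indicator B (Q \<omega>) * \<phi> (Q \<omega> ** U \<omega>))
        = (LINT \<omega>|M. indicator B (Q \<omega>) * haar_xtrace \<mu> A (Q \<omega>))"
      by (simp add: avg)
  qed (use assms in measurable)
  have loo: "AE \<omega> in M. cond_exp_given M Q (\<lambda>\<omega>. LeaveOneOutFull A (Q \<omega> ** U \<omega>)) \<omega> = haar_xtrace \<mu> A (Q \<omega>)"
    unfolding LeaveOneOutFull_def
    by (rule rotated[of "\<lambda>X. loo_trace A X (Max UNIV)"])
      (simp_all add: C integral_haar_loo_trace_eq_haar_xtrace[OF \<mu>])
  have xtrace: "AE \<omega> in M. cond_exp_given M Q (\<lambda>\<omega>. XTraceFull A (Q \<omega> ** U \<omega>)) \<omega> = haar_xtrace \<mu> A (Q \<omega>)"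
    by (rule rotated[of "XTraceFull A"])
      (simp_all add: C haar_xtrace_def borel_measurable_XTraceFull[OF measurable_ident, simplified])
  have gauss: "AE \<omega> in M. cond_exp_given M ?\<pi> (\<lambda>\<omega>. XTraceFull A (\<Omega> \<omega>)) \<omega> = H (?\<pi> \<omega>)"
  proof (rule cond_exp_given_eqI)
    show "integrable M (\<lambda>\<omega>. H (?\<pi> \<omega>))"
      using HD by (intro integral_bounded(1)[OF assms(1), of _ D]) auto
    fix B :: "(real ^ 'n ^ 'n) set" assume B: "B \<in> sets borel"
    show "(LINT \<omega>|M. indicator B (?\<pi> \<omega>) * XTraceFull A (\<Omega> \<omega>)) = (LINT \<omega>|M. indicator B (?\<pi> \<omega>) * H (?\<pi> \<omega>))"
      by (rule integral_XTraceFull_on_projector_event[OF assms(1) _ _ assms(5) \<mu> H HD HP B])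
        (simp_all add: distr_standard_gaussian_matrix[OF assms(1,3)])
  qed (simp_all add: assms(1) int(1))
  \<comment> \<open>This identifies the function of the projector with the function of \<open>Q\<close>.\<close>
  have HQ: "AE \<omega> in M. H (?\<pi> \<omega>) = haar_xtrace \<mu> A (Q \<omega>)"
    using assms(5)
  proof eventually_elim
    case (elim \<omega>)
    then show ?case
      using orth_projector_orthonormal_columns[of "Q \<omega>"] HP[of "Q \<omega>"] by simp
  qed
  have "AE \<omega> in M.
         cond_exp_given M ?\<pi> (\<lambda>\<omega>. XTraceFull A (\<Omega> \<omega>)) \<omega>
           = cond_exp_given M Q (\<lambda>\<omega>. LeaveOneOutFull A (Q \<omega> ** U \<omega>)) \<omega>
       \<and> cond_exp_given M Q (\<lambda>\<omega>. LeaveOneOutFull A (Q \<omega> ** U \<omega>)) \<omega>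
           = cond_exp_given M Q (\<lambda>\<omega>. XTraceFull A (Q \<omega> ** U \<omega>)) \<omega>"
    using gauss HQ loo xtrace by eventually_elim simp
  moreover have "LeaveOneOutFull A (P ** V) = LeaveOneOutFull A (P ** W)"
    if "orthogonal_matrix V" "orthogonal_matrix W" "column (Max UNIV) V = column (Max UNIV) W"
    for P :: "real ^ ('m::{finite,linorder}) ^ 'n" and V W
    unfolding LeaveOneOutFull_def by (rule loo_trace_last_column[OF that])
  moreover have "?\<pi> \<in> borel_measurable M" by measurable
  ultimately show ?thesis using int by blast
qed

end
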